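(* Let $S$ be a graded algebra and $f\in S_d$ a homogeneous element with $f\neq 0$ and $d\geq 1$. Let $\theta=\{\theta_i\}_{i\in\mathbb Z}$ be a twisting system on $S$ such that, for some $0\neq\lambda\in k$, $\theta_i(f)=\lambda^i f$ for every $i\in\mathbb Z$. Then the assignment $$\operatorname{NMF}^{\mathbb Z}_S(f)\to \operatorname{NMF}^{\mathbb Z}_{S^\theta}(f^\theta),\qquad \{\phi^i\}_{i\in\mathbb Z}\mapsto\{(\phi^i)^\theta\}_{i\in\mathbb Z}$$ is an equivalence functor; in particular $\operatorname{NMF}^{\mathbb Z}_S(f)\cong \operatorname{NMF}^{\mathbb Z}_{S^\theta}(f^\theta)$.
   Context: $k$ is a fixed field. A graded algebra is an $\mathbb N$-graded $k$-algebra $S=\bigoplus_{i\in\mathbb N}S_i$. $\operatorname{GrMod}S$ is the category of ($\mathbb Z$-)graded right $S$-modules with degree-preserving homomorphisms; $M(n)_i=M_{n+i}$. Noncommutative graded matrix factorizations: for a graded algebra $S$ and $f\in S_d$, a noncommutative graded right matrix factorization of $f$ over $S$ is a sequence $\{\phi^i:F^{i+1}\to F^i\}_{i\in\mathbb Z}$ of graded right $S$-module homomorphisms, where, for some $r\in\mathbb N$ (the rank), all $F^i$ are graded free right $S$-modules of rank $r$, such that for every $i\in\mathbb Z$ there are isomorphisms $F^{i+2}\cong\bigoplus_{s=1}^rS(-m_{i+2,s})=\bigoplus_{s=1}^rS(-m_{is}-d)$ and $F^i\cong\bigoplus_{s=1}^rS(-m_{is})$ in $\operatorname{GrMod}S$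 under which $\phi^i\phi^{i+1}:F^{i+2}\to F^i$ corresponds to left multiplication $f\cdot:\bigoplus_{s=1}^rS(-m_{is}-d)\to\bigoplus_{s=1}^rS(-m_{is})$. A morphism $\{\phi^i:F^{i+1}\to F^i\}\to\{\psi^i:G^{i+1}\to G^i\}$ is a sequence of graded right $S$-module homomorphisms $\{\mu^i:F^i\to G^i\}_{i\in\mathbb Z}$ with $\mu^i\phi^i=\psi^i\mu^{i+1}$ for all $i$. The resulting category is $\operatorname{NMF}^{\mathbb Z}_S(f)$. Twisting: a twisting system on $S$ is a sequence $\theta=\{\theta_i\}_{i\in\mathbb Z}$ of graded $k$-linear automorphisms of $S$ such that $\theta_i(a\theta_j(b))=\theta_i(a)\theta_{i+j}(b)$ for all $i,j\in\mathbb Z$, $a\in S_j$, $b\in S$; it is always assumed that $\theta_0=\operatorname{id}$. The twisted graded algebra $S^\theta$ equals $S$ as a graded $k$-vector space (an element $a\in S$ is written $a^\theta$ when viewed in $S^\theta$) with multiplication $a^\theta b^\theta=(a\theta_i(b))^\theta$ for $a\in S_i$, $b\in S$. For $M\in\operatorname{GrMod}S$, $M^\theta\in\operatorname{GrMod}S^\theta$ is $M$ as a graded vector space with action $m^\theta a^\theta=(m\theta_i(a))^\theta$ for $m\in M_i$, $a\in S$. For $\phi:M\to N$ in $\operatorname{GrMod}S$, $\phi^\theta:M^\theta\to N^\theta$ is defined by $\phi^\theta(m^\theta)=\phi(m)^\theta$. *)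

theory Defs
  imports "HOL-Algebra.Module" "HOL-Algebra.AbelCoset"
begin

section \<open>Categories and equivalence functors\<close>

text \<open>The same function may be a morphism between several pairs of objects (hom-sets are not
  required to be disjoint), so composition takes the three objects as arguments.\<close>

record ('o, 'h) precat =
  Ob :: "'o set"
  Hom :: "'o \<Rightarrow> 'o \<Rightarrow> 'h set"
  Id :: "'o \<Rightarrow> 'h"
  Comp :: "'o \<Rightarrow> 'o \<Rightarrow> 'o \<Rightarrow> 'h \<Rightarrow> 'h \<Rightarrow> 'h"

locale cat =
  fixes C :: "('o, 'h) precat"
  assumes Id_in: "X \<in> Ob C \<Longrightarrow> Id C X \<in> Hom C X X"
    and Comp_in: "\<lbrakk>X \<in> Ob C; Y \<in> Ob C; Z \<in> Ob C; g \<in> Hom C Y Z; h \<in> Hom C X Y\<rbrakk>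
      \<Longrightarrow> Comp C X Y Z g h \<in> Hom C X Z"
    and Comp_Id: "\<lbrakk>X \<in> Ob C; Y \<in> Ob C; h \<in> Hom C X Y\<rbrakk> \<Longrightarrow> Comp C X X Y h (Id C X) = h"
    and Id_Comp: "\<lbrakk>X \<in> Ob C; Y \<in> Ob C; h \<in> Hom C X Y\<rbrakk> \<Longrightarrow> Comp C X Y Y (Id C Y) h = h"
    and Comp_assoc: "\<lbrakk>W \<in> Ob C; X \<in> Ob C; Y \<in> Ob C; Z \<in> Ob C;
        g \<in> Hom C Y Z; h \<in> Hom C X Y; l \<in> Hom C W X\<rbrakk>
      \<Longrightarrow> Comp C W X Z (Comp C X Y Z g h) l = Comp C W Y Z g (Comp C W X Y h l)"

record ('o, 'h, 'p, 'l) prefun =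
  on_ob :: "'o \<Rightarrow> 'p"
  on_hom :: "'o \<Rightarrow> 'o \<Rightarrow> 'h \<Rightarrow> 'l"

locale cat_functor = dom: cat C + cod: cat D
  for C :: "('o, 'h) precat" and D :: "('p, 'l) precat" +
  fixes F :: "('o, 'h, 'p, 'l) prefun"
  assumes on_ob_in: "X \<in> Ob C \<Longrightarrow> on_ob F X \<in> Ob D"
    and on_hom_in: "\<lbrakk>X \<in> Ob C; Y \<in> Ob C; h \<in> Hom C X Y\<rbrakk>
      \<Longrightarrow> on_hom F X Y h \<in> Hom D (on_ob F X) (on_ob F Y)"
    and on_hom_Id: "X \<in> Ob C \<Longrightarrow> on_hom F X X (Id C X) = Id D (on_ob F X)"
    and on_hom_Comp: "\<lbrakk>X \<in> Ob C; Y \<in> Ob C; Z \<in> Ob C; g \<in> Hom C Y Z; h \<in> Hom C X Y\<rbrakk>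
      \<Longrightarrow> on_hom F X Z (Comp C X Y Z g h)
        = Comp D (on_ob F X) (on_ob F Y) (on_ob F Z) (on_hom F Y Z g) (on_hom F X Y h)"

definition id_fun :: "('o, 'h, 'o, 'h) prefun" where
  "id_fun = \<lparr>on_ob = (\<lambda>X. X), on_hom = (\<lambda>X Y h. h)\<rparr>"

definition comp_fun ::
  "('p, 'l, 'q, 'm) prefun \<Rightarrow> ('o, 'h, 'p, 'l) prefun \<Rightarrow> ('o, 'h, 'q, 'm) prefun" where
  "comp_fun G F = \<lparr>on_ob = (\<lambda>X. on_ob G (on_ob F X)),
     on_hom = (\<lambda>X Y h. on_hom G (on_ob F X) (on_ob F Y) (on_hom F X Y h))\<rparr>"

definition iso_arrow :: "('o, 'h) precat \<Rightarrow> 'o \<Rightarrow> 'o \<Rightarrow> 'h \<Rightarrow> bool" where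
  "iso_arrow C X Y h \<longleftrightarrow> h \<in> Hom C X Y \<and>
     (\<exists>g\<in>Hom C Y X. Comp C X Y X g h = Id C X \<and> Comp C Y X Y h g = Id C Y)"

definition naturally_isomorphic ::
  "('o, 'h) precat \<Rightarrow> ('p, 'l) precat \<Rightarrow> ('o, 'h, 'p, 'l) prefun \<Rightarrow> ('o, 'h, 'p, 'l) prefun \<Rightarrow> bool"
where
  "naturally_isomorphic C D F G \<longleftrightarrow> (\<exists>\<eta>.
     (\<forall>X\<in>Ob C. iso_arrow D (on_ob F X) (on_ob G X) (\<eta> X)) \<and>
     (\<forall>X\<in>Ob C. \<forall>Y\<in>Ob C. \<forall>h\<in>Hom C X Y.
        Comp D (on_ob F X) (on_ob F Y) (on_ob G Y) (\<eta> Y) (on_hom F X Y h)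
        = Comp D (on_ob F X) (on_ob G X) (on_ob G Y) (on_hom G X Y h) (\<eta> X)))"

definition equivalence_functor ::
  "('o, 'h) precat \<Rightarrow> ('p, 'l) precat \<Rightarrow> ('o, 'h, 'p, 'l) prefun \<Rightarrow> bool" where
  "equivalence_functor C D F \<longleftrightarrow> cat_functor C D F \<and>
     (\<exists>G. cat_functor D C G \<and>
        naturally_isomorphic C C (comp_fun G F) id_fun \<and>
        naturally_isomorphic D D (comp_fun F G) id_fun)"

definition equivalent_categories :: "('o, 'h) precat \<Rightarrow> ('p, 'l) precat \<Rightarrow> bool" where
  "equivalent_categories C D \<longleftrightarrow> (\<exists>F. equivalence_functor C D F)"


section \<open>Graded algebras and graded right modules\<close>

definition hdecomp :: "('a, 'b) ring_scheme \<Rightarrow> (int \<Rightarrow> 'a set) \<Rightarrow> 'a \<Rightarrow> (int \<Rightarrow> 'a) \<Rightarrow> bool" where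
  "hdecomp M A x c \<longleftrightarrow> (\<forall>i. c i \<in> A i) \<and> finite {i. c i \<noteq> \<zero>\<^bsub>M\<^esub>} \<and>
     x = (\<Oplus>\<^bsub>M\<^esub>i\<in>{i. c i \<noteq> \<zero>\<^bsub>M\<^esub>}. c i)"

definition internal_direct_sum :: "('a, 'b) ring_scheme \<Rightarrow> (int \<Rightarrow> 'a set) \<Rightarrow> bool" where
  "internal_direct_sum M A \<longleftrightarrow> (\<forall>i. additive_subgroup (A i) M) \<and>
     (\<forall>x\<in>carrier M. \<exists>!c. hdecomp M A x c)"

text \<open>The homogeneous component of degree \<^term>\<open>i\<close> of \<^term>\<open>x\<close>.\<close>

definition hcomp :: "('a, 'b) ring_scheme \<Rightarrow> (int \<Rightarrow> 'a set) \<Rightarrow> 'a \<Rightarrow> int \<Rightarrow> 'a" where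
  "hcomp M A x i = (THE c. hdecomp M A x c) i"

text \<open>An \<open>\<nat>\<close>-graded algebra is indexed by the integers, with zero parts in negative degrees.
  The multiplication need not be commutative, so the library locale for algebras does not apply.\<close>

record ('k, 'a) gr_algebra = "('k, 'a) module" +
  part :: "int \<Rightarrow> 'a set"

locale graded_algebra =
  fixes K :: "('k, 'c) ring_scheme" and S :: "('k, 'a) gr_algebra"
  assumes field_K: "field K"
    and vector_space_S: "module K S"
    and ring_S: "ring S"
    and smult_mult: "\<lbrakk>c \<in> carrier K; a \<in> carrier S; b \<in> carrier S\<rbrakk>
      \<Longrightarrow> (c \<odot>\<^bsub>S\<^esub> a) \<otimes>\<^bsub>S\<^esub> b = c \<odot>\<^bsub>S\<^esub> (a \<otimes>\<^bsub>S\<^esub> b)"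
    and mult_smult: "\<lbrakk>c \<in> carrier K; a \<in> carrier S; b \<in> carrier S\<rbrakk>
      \<Longrightarrow> a \<otimes>\<^bsub>S\<^esub> (c \<odot>\<^bsub>S\<^esub> b) = c \<odot>\<^bsub>S\<^esub> (a \<otimes>\<^bsub>S\<^esub> b)"
    and part_submodule: "submodule (part S i) K S"
    and part_direct_sum: "internal_direct_sum S (part S)"
    and part_neg: "i < 0 \<Longrightarrow> part S i = {\<zero>\<^bsub>S\<^esub>}"
    and part_one: "\<one>\<^bsub>S\<^esub> \<in> part S 0"
    and part_mult: "\<lbrakk>a \<in> part S i; b \<in> part S j\<rbrakk> \<Longrightarrow> a \<otimes>\<^bsub>S\<^esub> b \<in> part S (i + j)"

text \<open>As in the library's record for modules, the multiplicative fields inherited from rings are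
  ignored.\<close>

record ('a, 'm) gr_module = "'m ring" +
  ract :: "'m \<Rightarrow> 'a \<Rightarrow> 'm"
  mpart :: "int \<Rightarrow> 'm set"

locale graded_right_module = graded_algebra K S
  for K :: "('k, 'c) ring_scheme" and S :: "('k, 'a) gr_algebra" +
  fixes M :: "('a, 'm) gr_module"
  assumes abelian_group_M: "abelian_group M"
    and ract_closed: "\<lbrakk>x \<in> carrier M; a \<in> carrier S\<rbrakk> \<Longrightarrow> ract M x a \<in> carrier M"
    and ract_l_distr: "\<lbrakk>x \<in> carrier M; y \<in> carrier M; a \<in> carrier S\<rbrakk>
      \<Longrightarrow> ract M (x \<oplus>\<^bsub>M\<^esub> y) a = ract M x a \<oplus>\<^bsub>M\<^esub> ract M y a"
    and ract_r_distr: "\<lbrakk>x \<in> carrier M; a \<in> carrier S; b \<in> carrier S\<rbrakk>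
      \<Longrightarrow> ract M x (a \<oplus>\<^bsub>S\<^esub> b) = ract M x a \<oplus>\<^bsub>M\<^esub> ract M x b"
    and ract_assoc: "\<lbrakk>x \<in> carrier M; a \<in> carrier S; b \<in> carrier S\<rbrakk>
      \<Longrightarrow> ract M x (a \<otimes>\<^bsub>S\<^esub> b) = ract M (ract M x a) b"
    and ract_one: "x \<in> carrier M \<Longrightarrow> ract M x \<one>\<^bsub>S\<^esub> = x"
    and mpart_direct_sum: "internal_direct_sum M (mpart M)"
    and mpart_ract: "\<lbrakk>x \<in> mpart M i; a \<in> part S j\<rbrakk> \<Longrightarrow> ract M x a \<in> mpart M (i + j)"

text \<open>Homomorphisms are made extensional, so that equality of maps is equality on the carrier.\<close>

definition gr_hom ::
  "('k, 'a) gr_algebra \<Rightarrow> ('a, 'm) gr_module \<Rightarrow> ('a, 'n) gr_module \<Rightarrow> ('m \<Rightarrow> 'n) set" where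
  "gr_hom S M N = {h \<in> extensional (carrier M). h \<in> hom (add_monoid M) (add_monoid N) \<and>
     (\<forall>x\<in>carrier M. \<forall>a\<in>carrier S. h (ract M x a) = ract N (h x) a) \<and>
     (\<forall>i. h ` mpart M i \<subseteq> mpart N i)}"

definition gr_iso ::
  "('k, 'a) gr_algebra \<Rightarrow> ('a, 'm) gr_module \<Rightarrow> ('a, 'n) gr_module \<Rightarrow> ('m \<Rightarrow> 'n) set" where
  "gr_iso S M N = {h \<in> gr_hom S M N. \<exists>g\<in>gr_hom S N M.
     (\<forall>x\<in>carrier M. g (h x) = x) \<and> (\<forall>y\<in>carrier N. h (g y) = y)}"

definition regular_module :: "('k, 'a) gr_algebra \<Rightarrow> ('a, 'a) gr_module" where
  "regular_module S = \<lparr>carrier = carrier S, mult = mult S, one = one S, zero = zero S, add = add S,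
     ract = mult S, mpart = part S\<rparr>"

definition shift_module :: "('a, 'm) gr_module \<Rightarrow> int \<Rightarrow> ('a, 'm) gr_module" where
  "shift_module M n = M\<lparr>mpart := (\<lambda>i. mpart M (n + i))\<rparr>"

definition direct_sum_module ::
  "nat \<Rightarrow> (nat \<Rightarrow> ('a, 'm) gr_module) \<Rightarrow> ('a, nat \<Rightarrow> 'm) gr_module" where
  "direct_sum_module r M = \<lparr>carrier = (\<Pi>\<^sub>E s\<in>{1..r}. carrier (M s)),
     mult = undefined, one = undefined,
     zero = (\<lambda>s\<in>{1..r}. \<zero>\<^bsub>M s\<^esub>),
     add = (\<lambda>x y. \<lambda>s\<in>{1..r}. x s \<oplus>\<^bsub>M s\<^esub> y s),
     ract = (\<lambda>x a. \<lambda>s\<in>{1..r}. ract (M s) (x s) a),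
     mpart = (\<lambda>i. \<Pi>\<^sub>E s\<in>{1..r}. mpart (M s) i)\<rparr>"

text \<open>The module \<open>S(n\<^sub>1) \<oplus> \<dots> \<oplus> S(n\<^sub>r)\<close>.\<close>

definition free_module ::
  "('k, 'a) gr_algebra \<Rightarrow> nat \<Rightarrow> (nat \<Rightarrow> int) \<Rightarrow> ('a, nat \<Rightarrow> 'a) gr_module" where
  "free_module S r n = direct_sum_module r (\<lambda>s. shift_module (regular_module S) (n s))"

definition graded_free :: "('k, 'a) gr_algebra \<Rightarrow> nat \<Rightarrow> ('a, 'm) gr_module \<Rightarrow> bool" where
  "graded_free S r M \<longleftrightarrow> (\<exists>n. gr_iso S M (free_module S r n) \<noteq> {})"

definition left_mult :: "('k, 'a) gr_algebra \<Rightarrow> nat \<Rightarrow> 'a \<Rightarrow> (nat \<Rightarrow> 'a) \<Rightarrow> (nat \<Rightarrow> 'a)" where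
  "left_mult S r f x = (\<lambda>s\<in>{1..r}. f \<otimes>\<^bsub>S\<^esub> x s)"


section \<open>Noncommutative graded right matrix factorizations\<close>

text \<open>\<^term>\<open>fmap X i\<close> is the map from \<^term>\<open>fmod X (i + 1)\<close> to \<^term>\<open>fmod X i\<close>.\<close>

record ('a, 'm) factorization =
  fmod :: "int \<Rightarrow> ('a, 'm) gr_module"
  fmap :: "int \<Rightarrow> 'm \<Rightarrow> 'm"

text \<open>In \<open>is_nmf\<close>, the integer \<open>m i s\<close> is the \<open>m\<^sub>i\<^sub>s\<close> of the usual notation: one family of degrees
  serves all \<open>i\<close>, while the pair of isomorphisms \<open>\<alpha>, \<beta>\<close> may depend on \<open>i\<close>.\<close>

definition is_nmf ::
  "('k, 'c) ring_scheme \<Rightarrow> ('k, 'a) gr_algebra \<Rightarrow> nat \<Rightarrow> 'a \<Rightarrow> ('a, 'm) factorization \<Rightarrow> bool" where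
  "is_nmf K S d f X \<longleftrightarrow>
     (\<forall>i. graded_right_module K S (fmod X i)) \<and>
     (\<forall>i. fmap X i \<in> gr_hom S (fmod X (i + 1)) (fmod X i)) \<and>
     (\<exists>r. (\<forall>i. graded_free S r (fmod X i)) \<and>
        (\<exists>m :: int \<Rightarrow> nat \<Rightarrow> int. \<forall>i. (\<forall>s\<in>{1..r}. m (i + 2) s = m i s + int d) \<and>
           (\<exists>\<alpha>\<in>gr_iso S (fmod X (i + 2)) (free_module S r (\<lambda>s. - m i s - int d)).
            \<exists>\<beta>\<in>gr_iso S (fmod X i) (free_module S r (\<lambda>s. - m i s)).
              \<forall>x\<in>carrier (fmod X (i + 2)).
                \<beta> (fmap X i (fmap X (i + 1) x)) = left_mult S r f (\<alpha> x))))"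

definition nmf_hom ::
  "('k, 'a) gr_algebra \<Rightarrow> ('a, 'm) factorization \<Rightarrow> ('a, 'm) factorization \<Rightarrow> (int \<Rightarrow> 'm \<Rightarrow> 'm) set"
where
  "nmf_hom S X Y = {\<mu>. (\<forall>i. \<mu> i \<in> gr_hom S (fmod X i) (fmod Y i)) \<and>
     (\<forall>i. \<forall>x\<in>carrier (fmod X (i + 1)). \<mu> i (fmap X i x) = fmap Y i (\<mu> (i + 1) x))}"

text \<open>The matrix factorizations whose modules live in the type \<^typ>\<open>'m\<close>, which plays the role of
  a universe.\<close>

definition NMF ::
  "('k, 'c) ring_scheme \<Rightarrow> ('k, 'a) gr_algebra \<Rightarrow> nat \<Rightarrow> 'a \<Rightarrow>
     (('a, 'm) factorization, int \<Rightarrow> 'm \<Rightarrow> 'm) precat" where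
  "NMF K S d f = \<lparr>Ob = {X. is_nmf K S d f X},
     Hom = nmf_hom S,
     Id = (\<lambda>X i. \<lambda>x\<in>carrier (fmod X i). x),
     Comp = (\<lambda>X Y Z \<nu> \<mu> i. compose (carrier (fmod X i)) (\<nu> i) (\<mu> i))\<rparr>"


section \<open>Twisting\<close>

definition graded_linear_automorphism ::
  "('k, 'c) ring_scheme \<Rightarrow> ('k, 'a) gr_algebra \<Rightarrow> ('a \<Rightarrow> 'a) \<Rightarrow> bool" where
  "graded_linear_automorphism K S h \<longleftrightarrow> bij_betw h (carrier S) (carrier S) \<and>
     (\<forall>a\<in>carrier S. \<forall>b\<in>carrier S. h (a \<oplus>\<^bsub>S\<^esub> b) = h a \<oplus>\<^bsub>S\<^esub> h b) \<and>
     (\<forall>c\<in>carrier K. \<forall>a\<in>carrier S. h (c \<odot>\<^bsub>S\<^esub> a) = c \<odot>\<^bsub>S\<^esub> h a) \<and>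
     (\<forall>i. h ` part S i = part S i)"

definition twisting_system ::
  "('k, 'c) ring_scheme \<Rightarrow> ('k, 'a) gr_algebra \<Rightarrow> (int \<Rightarrow> 'a \<Rightarrow> 'a) \<Rightarrow> bool" where
  "twisting_system K S \<theta> \<longleftrightarrow>
     (\<forall>i. graded_linear_automorphism K S (\<theta> i)) \<and>
     (\<forall>i j. \<forall>a\<in>part S j. \<forall>b\<in>carrier S.
        \<theta> i (a \<otimes>\<^bsub>S\<^esub> \<theta> j b) = \<theta> i a \<otimes>\<^bsub>S\<^esub> \<theta> (i + j) b) \<and>
     (\<forall>a\<in>carrier S. \<theta> 0 a = a)"

text \<open>The twisted multiplication and action are prescribed on homogeneous left arguments and
  extended additively: the left argument is split into its homogeneous components.\<close>

definition twist_algebra :: "(int \<Rightarrow> 'a \<Rightarrow> 'a) \<Rightarrow> ('k, 'a) gr_algebra \<Rightarrow> ('k, 'a) gr_algebra" where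
  "twist_algebra \<theta> S = S\<lparr>mult := (\<lambda>a b.
     \<Oplus>\<^bsub>S\<^esub>i\<in>{i. hcomp S (part S) a i \<noteq> \<zero>\<^bsub>S\<^esub>}. hcomp S (part S) a i \<otimes>\<^bsub>S\<^esub> \<theta> i b)\<rparr>"

definition twist_module :: "(int \<Rightarrow> 'a \<Rightarrow> 'a) \<Rightarrow> ('a, 'm) gr_module \<Rightarrow> ('a, 'm) gr_module" where
  "twist_module \<theta> M = M\<lparr>ract := (\<lambda>x a.
     \<Oplus>\<^bsub>M\<^esub>i\<in>{i. hcomp M (mpart M) x i \<noteq> \<zero>\<^bsub>M\<^esub>}. ract M (hcomp M (mpart M) x i) (\<theta> i a))\<rparr>"

text \<open>Since a module and its twist have the same underlying set, a homomorphism and its twist are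
  the same function.\<close>

definition twist_map :: "(int \<Rightarrow> 'a \<Rightarrow> 'a) \<Rightarrow> ('m \<Rightarrow> 'n) \<Rightarrow> ('m \<Rightarrow> 'n)" where
  "twist_map \<theta> h = h"

definition twist_factorization ::
  "(int \<Rightarrow> 'a \<Rightarrow> 'a) \<Rightarrow> ('a, 'm) factorization \<Rightarrow> ('a, 'm) factorization" where
  "twist_factorization \<theta> X = \<lparr>fmod = (\<lambda>i. twist_module \<theta> (fmod X i)),
     fmap = (\<lambda>i. twist_map \<theta> (fmap X i))\<rparr>"

definition twist_functor :: "(int \<Rightarrow> 'a \<Rightarrow> 'a) \<Rightarrow>
    (('a, 'm) factorization, int \<Rightarrow> 'm \<Rightarrow> 'm, ('a, 'm) factorization, int \<Rightarrow> 'm \<Rightarrow> 'm) prefun" where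
  "twist_functor \<theta> = \<lparr>on_ob = twist_factorization \<theta>,
     on_hom = (\<lambda>X Y \<mu> i. twist_map \<theta> (\<mu> i))\<rparr>"

end

theory Submission
  imports Defs
begin

text \<open>The inverse family \<open>\<theta>\<inverse>\<close> is a twisting system on \<open>S\<^sup>\<theta>\<close>, and twisting by it turns
  \<open>S\<^sup>\<theta>\<close> and \<open>M\<^sup>\<theta>\<close> back into \<open>S\<close> and \<open>M\<close>; so only functoriality of one twist has to be shown,
  in a setting symmetric in \<open>S\<close> and \<open>S\<^sup>\<theta>\<close>. The point is that the twist of a factorization of \<open>f\<close> is
  one of \<open>f\<close> again. The maps \<open>\<theta>\<^sub>m\<inverse>\<close> identify \<open>S(-m)\<^sup>\<theta>\<close> with \<open>S\<^sup>\<theta>(-m)\<close>, and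
  \<open>\<theta>\<^sub>m (f \<theta>\<^sub>d a) = \<theta>\<^sub>m f \<theta>\<^sub>m\<^sub>+\<^sub>d a = \<lambda>\<^sup>m f \<theta>\<^sub>m\<^sub>+\<^sub>d a\<close> shows that under them left multiplication by \<open>f\<close> on \<open>S\<close>
  becomes left multiplication by \<open>f\<close> on \<open>S\<^sup>\<theta>\<close> up to the unit \<open>\<lambda>\<^sup>m\<close>, which is absorbed into the
  identification of the source.\<close>

section \<open>Graded abelian groups\<close>

text \<open>Algebras and modules share their additive grading, so the facts about homogeneous
  components are proved once for both.\<close>

locale graded_group = abelian_group M for M (structure) +
  fixes A :: "int \<Rightarrow> 'b set"
  assumes direct_sum: "internal_direct_sum M A"
begin

lemma part_subgroup: "subgroup (A i) (add_monoid M)"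
  using direct_sum by (simp add: internal_direct_sum_def additive_subgroup.a_subgroup)

lemma part_carrier: "x \<in> A i \<Longrightarrow> x \<in> carrier M"
  using subgroup.subset[OF part_subgroup] by auto

lemma part_zero: "\<zero> \<in> A i"
  using subgroup.one_closed[OF part_subgroup] by simp

lemma part_add: "x \<in> A i \<Longrightarrow> y \<in> A i \<Longrightarrow> x \<oplus> y \<in> A i"
  using subgroup.m_closed[OF part_subgroup] by simp

lemma hdecomp_hcomp:
  assumes "x \<in> carrier M"
  shows "hdecomp M A x (hcomp M A x)"
proof -
  have "\<exists>!c. hdecomp M A x c"
    using direct_sum assms by (simp add: internal_direct_sum_def)
  from theI'[OF this] show ?thesis
    by (simp add: hcomp_def [abs_def])
qed

lemma hcomp_in: "x \<in> carrier M \<Longrightarrow> hcomp M A x i \<in> A i"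
  using hdecomp_hcomp by (simp add: hdecomp_def)

lemma finite_hcomp: "x \<in> carrier M \<Longrightarrow> finite {i. hcomp M A x i \<noteq> \<zero>}"
  using hdecomp_hcomp by (simp add: hdecomp_def)

lemma hcomp_unique:
  assumes x: "x \<in> carrier M" and "hdecomp M A x c"
  shows "hcomp M A x = c"
proof -
  have "\<exists>!c. hdecomp M A x c"
    using direct_sum x by (simp add: internal_direct_sum_def)
  then show ?thesis using hdecomp_hcomp[OF x] assms(2) by blast
qed

text \<open>\<open>hdecomp\<close> sums over the exact support. Zero terms may be added freely, so
  any finite set containing the support can index the sum.\<close>

lemma hdecompI:
  assumes c: "\<And>i. c i \<in> A i" and F: "finite F" "\<And>i. i \<notin> F \<Longrightarrow> c i = \<zero>"
    and x: "x = (\<Oplus>i\<in>F. c i)"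
  shows "hdecomp M A x c"
proof -
  have sub: "{i. c i \<noteq> \<zero>} \<subseteq> F" using F(2) by auto
  have "(\<Oplus>i\<in>{i. c i \<noteq> \<zero>}. c i) = (\<Oplus>i\<in>F. c i)"
    by (rule add.finprod_mono_neutral_cong_left)
      (use F(1) sub c part_carrier in auto)
  then show ?thesis
    unfolding hdecomp_def using c x finite_subset[OF sub F(1)] by auto
qed

lemma hcomp_homogeneous:
  assumes "x \<in> A i"
  shows "hcomp M A x = (\<lambda>j. if j = i then x else \<zero>)"
proof (rule hcomp_unique)
  show "x \<in> carrier M" using assms by (rule part_carrier)
  show "hdecomp M A x (\<lambda>j. if j = i then x else \<zero>)"
    by (rule hdecompI[of _ "{i}"]) (use assms part_zero part_carrier in auto)
qed

lemma hcomp_add: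
  assumes x: "x \<in> carrier M" and y: "y \<in> carrier M"
  shows "hcomp M A (x \<oplus> y) = (\<lambda>i. hcomp M A x i \<oplus> hcomp M A y i)"
proof (rule hcomp_unique)
  show "x \<oplus> y \<in> carrier M" using x y by simp
  \<comment> \<open>A common index set for all three sums: it contains the support of
    \<open>x \<oplus> y\<close>, which is smaller when components cancel.\<close>
  let ?F = "{i. hcomp M A x i \<noteq> \<zero>} \<union> {i. hcomp M A y i \<noteq> \<zero>}"
  have F: "finite ?F" using x y finite_hcomp by simp
  have sum: "z = (\<Oplus>i\<in>?F. hcomp M A z i)"
    if z: "z \<in> carrier M" and sub: "{i. hcomp M A z i \<noteq> \<zero>} \<subseteq> ?F" for z
  proof -
    have "z = (\<Oplus>i\<in>{i. hcomp M A z i \<noteq> \<zero>}. hcomp M A z i)"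
      using hdecomp_hcomp[OF z] by (simp add: hdecomp_def)
    also have "\<dots> = (\<Oplus>i\<in>?F. hcomp M A z i)"
      by (rule add.finprod_mono_neutral_cong_left)
        (use F sub hcomp_in[OF z] part_carrier in auto)
    finally show ?thesis .
  qed
  have "x \<oplus> y = (\<Oplus>i\<in>?F. hcomp M A x i) \<oplus> (\<Oplus>i\<in>?F. hcomp M A y i)"
    using sum[OF x] sum[OF y] by simp
  also have "\<dots> = (\<Oplus>i\<in>?F. hcomp M A x i \<oplus> hcomp M A y i)"
    by (rule finsum_addf[symmetric]) (use x y hcomp_in part_carrier in auto)
  finally show "hdecomp M A (x \<oplus> y) (\<lambda>i. hcomp M A x i \<oplus> hcomp M A y i)"
    by (intro hdecompI[of _ ?F]) (use F x y hcomp_in part_add in auto)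
qed

text \<open>Each element is the finite sum of its components. This reduces an additive identity to
  homogeneous arguments, where twisted operations have an explicit formula.\<close>

lemma homogeneous_induct [consumes 1, case_names homogeneous add]:
  assumes x: "x \<in> carrier M"
    and hom: "\<And>i x. x \<in> A i \<Longrightarrow> P x"
    and add: "\<And>x y. \<lbrakk>x \<in> carrier M; y \<in> carrier M; P x; P y\<rbrakk> \<Longrightarrow> P (x \<oplus> y)"
  shows "P x"
proof -
  have "P (\<Oplus>i\<in>F. hcomp M A x i)" if "finite F" for F
    using that
  proof (induction F)
    case empty
    \<comment> \<open>The empty sum is \<open>\<zero>\<close>, which is homogeneous of every
      degree.\<close>
    show ?case using hom[OF part_zero] by simp
  next
    case (insert j F)
    have c: "hcomp M A x i \<in> carrier M" for i
      using hcomp_in[OF x] part_carrier by blast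
    have "P (hcomp M A x j \<oplus> (\<Oplus>i\<in>F. hcomp M A x i))"
      by (rule add) (use c insert.IH hom[OF hcomp_in[OF x]] in auto)
    then show ?case using insert.hyps c by simp
  qed
  from this[OF finite_hcomp[OF x]] show ?thesis
    using hdecomp_hcomp[OF x] by (simp add: hdecomp_def)
qed

section \<open>Additive extension of maps prescribed on homogeneous elements\<close>

context
  fixes g :: "int \<Rightarrow> 'b \<Rightarrow> 'b"
  assumes g_closed: "\<And>i x. x \<in> A i \<Longrightarrow> g i x \<in> carrier M"
    and g_add: "\<And>i x y. \<lbrakk>x \<in> A i; y \<in> A i\<rbrakk> \<Longrightarrow> g i (x \<oplus> y) = g i x \<oplus> g i y"
begin

text \<open>Choosing \<open>g i x\<close> as \<open>x\<close> multiplied on the right by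
  \<open>\<theta> i b\<close> yields the formulas in \<open>twist_algebra\<close> and
  \<open>twist_module\<close>.\<close>

abbreviation additive_extension :: "'b \<Rightarrow> 'b" where
  "additive_extension x \<equiv> \<Oplus>i\<in>{i. hcomp M A x i \<noteq> \<zero>}. g i (hcomp M A x i)"

lemma g_zero: "g i \<zero> = \<zero>"
proof -
  have "g i \<zero> \<oplus> g i \<zero> = g i \<zero>"
    using g_add[OF part_zero part_zero, of i] by simp
  then show ?thesis using g_closed[OF part_zero, of i] by simp
qed

text \<open>Since \<open>g i\<close> sends zero to zero, indices with zero component contribute
  nothing. A fixed index set makes the sums for different arguments comparable.\<close>

lemma additive_extension_superset:
  assumes x: "x \<in> carrier M" and F: "finite F" "{i. hcomp M A x i \<noteq> \<zero>} \<subseteq> F"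
  shows "additive_extension x = (\<Oplus>i\<in>F. g i (hcomp M A x i))"
  by (rule add.finprod_mono_neutral_cong_left)
    (use F g_zero g_closed[OF hcomp_in[OF x]] in auto)

lemma additive_extension_closed: "x \<in> carrier M \<Longrightarrow> additive_extension x \<in> carrier M"
  by (intro finsum_closed) (use g_closed hcomp_in in auto)

lemma additive_extension_homogeneous:
  assumes "x \<in> A i"
  shows "additive_extension x = g i x"
proof -
  have "additive_extension x = (\<Oplus>j\<in>{i}. g j (hcomp M A x j))"
    by (rule additive_extension_superset)
      (use assms part_carrier hcomp_homogeneous[OF assms] in auto)
  then show ?thesis
    using g_closed[OF assms] hcomp_homogeneous[OF assms] by simp
qed

lemma additive_extension_add:
  assumes x: "x \<in> carrier M" and y: "y \<in> carrier M"
  shows "additive_extension (x \<oplus> y) = additive_extension x \<oplus> additive_extension y"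
proof -
  let ?F = "{i. hcomp M A x i \<noteq> \<zero>} \<union> {i. hcomp M A y i \<noteq> \<zero>}"
  have F: "finite ?F" using x y finite_hcomp by simp
  have "additive_extension (x \<oplus> y) = (\<Oplus>i\<in>?F. g i (hcomp M A (x \<oplus> y) i))"
    by (rule additive_extension_superset) (use F x y hcomp_add in auto)
  also have "\<dots> = (\<Oplus>i\<in>?F. g i (hcomp M A x i) \<oplus> g i (hcomp M A y i))"
    by (rule finsum_cong)
      (use x y g_closed g_add hcomp_in in \<open>auto simp: hcomp_add simp_implies_def\<close>)
  also have "\<dots> = (\<Oplus>i\<in>?F. g i (hcomp M A x i)) \<oplus> (\<Oplus>i\<in>?F. g i (hcomp M A y i))"
    by (rule finsum_addf) (use x y g_closed hcomp_in in auto)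
  also have "\<dots> = additive_extension x \<oplus> additive_extension y"
    using F x y additive_extension_superset[of x ?F] additive_extension_superset[of y ?F] by auto
  finally show ?thesis .
qed

end

end

section \<open>Graded modules and their homomorphisms\<close>

text \<open>Regular modules and twists leave the additive group unchanged. This and the next two
  lemmas carry its group structure and grading over to the new record.\<close>

lemma hdecomp_cong:
  assumes "carrier M = carrier N" "add M = add N" "zero M = zero N"
  shows "hdecomp M A = hdecomp N A"
  using assms by (intro ext) (simp add: hdecomp_def finsum_def finprod_def)

lemma internal_direct_sum_cong:
  assumes "carrier M = carrier N" "add M = add N" "zero M = zero N"
  shows "internal_direct_sum M A = internal_direct_sum N A"
  using assms hdecomp_cong[OF assms, of A]
  by (simp add: internal_direct_sum_def additive_subgroup_def subgroup_def m_inv_def)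

lemma abelian_group_cong:
  assumes "carrier M = carrier N" "add M = add N" "zero M = zero N" "abelian_group N"
  shows "abelian_group M"
  using abelian_groupE[OF assms(4)] by (intro abelian_groupI) (auto simp: assms(1-3))

context graded_algebra
begin

sublocale S: ring S
  by (rule ring_S)

sublocale V: module K S
  by (rule vector_space_S)

sublocale S: graded_group S "part S"
  by unfold_locales (rule part_direct_sum)

lemma part_smult: "c \<in> carrier K \<Longrightarrow> a \<in> part S i \<Longrightarrow> c \<odot>\<^bsub>S\<^esub> a \<in> part S i"
  using part_submodule[of i] by (rule submodule.smult_closed)

lemma regular_module_simps [simp]:
  "carrier (regular_module S) = carrier S" "add (regular_module S) = add S"
  "zero (regular_module S) = zero S" "ract (regular_module S) = mult S"
  "mpart (regular_module S) = part S"
  by (simp_all add: regular_module_def)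

text \<open>As a right module over itself, the algebra becomes a case of the twisted action, so ring
  laws of the twisted algebra can be read off from module laws.\<close>

lemma graded_right_module_regular: "graded_right_module K S (regular_module S)"
proof -
  have "abelian_group (regular_module S)"
    by (rule abelian_group_cong[of _ S]) (simp_all add: ring.axioms(1)[OF ring_S])
  moreover have "internal_direct_sum (regular_module S) (part S)"
    using internal_direct_sum_cong[of "regular_module S" S] part_direct_sum by simp
  ultimately show ?thesis
    by (intro graded_right_module.intro graded_algebra_axioms graded_right_module_axioms.intro)
      (simp_all add: S.l_distr S.r_distr S.m_assoc part_mult)
qed

end

context graded_right_module
begin

sublocale M: abelian_group M
  by (rule abelian_group_M)

sublocale M: graded_group M "mpart M"
  by unfold_locales (rule mpart_direct_sum)

end

lemma gr_hom_closed: "h \<in> gr_hom S M N \<Longrightarrow> x \<in> carrier M \<Longrightarrow> h x \<in> carrier N"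
  by (auto simp: gr_hom_def hom_def)

lemma gr_hom_add:
  "\<lbrakk>h \<in> gr_hom S M N; x \<in> carrier M; y \<in> carrier M\<rbrakk> \<Longrightarrow> h (x \<oplus>\<^bsub>M\<^esub> y) = h x \<oplus>\<^bsub>N\<^esub> h y"
  by (auto simp: gr_hom_def hom_def)

lemma gr_hom_ract:
  "\<lbrakk>h \<in> gr_hom S M N; x \<in> carrier M; a \<in> carrier S\<rbrakk> \<Longrightarrow> h (ract M x a) = ract N (h x) a"
  by (auto simp: gr_hom_def)

lemma gr_hom_part: "h \<in> gr_hom S M N \<Longrightarrow> x \<in> mpart M i \<Longrightarrow> h x \<in> mpart N i"
  by (auto simp: gr_hom_def image_subset_iff)

lemma gr_hom_extensional: "h \<in> gr_hom S M N \<Longrightarrow> h \<in> extensional (carrier M)"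
  by (auto simp: gr_hom_def)

lemma gr_homI:
  assumes "h \<in> extensional (carrier M)"
    and "\<And>x. x \<in> carrier M \<Longrightarrow> h x \<in> carrier N"
    and "\<And>x y. \<lbrakk>x \<in> carrier M; y \<in> carrier M\<rbrakk> \<Longrightarrow> h (x \<oplus>\<^bsub>M\<^esub> y) = h x \<oplus>\<^bsub>N\<^esub> h y"
    and "\<And>x a. \<lbrakk>x \<in> carrier M; a \<in> carrier S\<rbrakk> \<Longrightarrow> h (ract M x a) = ract N (h x) a"
    and "\<And>i x. x \<in> mpart M i \<Longrightarrow> h x \<in> mpart N i"
  shows "h \<in> gr_hom S M N"
  using assms by (auto simp: gr_hom_def hom_def)

lemma gr_hom_compose:
  assumes M: "graded_right_module K S M"
    and h: "h \<in> gr_hom S M N" and g: "g \<in> gr_hom S N P"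
  shows "compose (carrier M) g h \<in> gr_hom S M P"
proof -
  interpret graded_right_module K S M by (rule M)
  show ?thesis
    by (rule gr_homI)
      (use h g in \<open>auto simp: compose_eq M.part_carrier ract_closed gr_hom_closed[OF h]
        gr_hom_closed[OF g] gr_hom_add[OF h] gr_hom_add[OF g] gr_hom_ract[OF h] gr_hom_ract[OF g]
        gr_hom_part[OF h] gr_hom_part[OF g]\<close>)
qed

text \<open>Agreement of the actions on the carrier is exactly what twisting forth and back
  provides; \<open>M = N\<close> gives the identity arrows.\<close>

lemma gr_hom_identity:
  assumes M: "graded_right_module K S M" and N: "graded_right_module K S N"
    and eq: "carrier M = carrier N" "add M = add N" "mpart M = mpart N"
      "\<And>x a. \<lbrakk>x \<in> carrier M; a \<in> carrier S\<rbrakk> \<Longrightarrow> ract M x a = ract N x a"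
  shows "(\<lambda>x\<in>carrier M. x) \<in> gr_hom S M N"
proof -
  interpret graded_right_module K S M by (rule M)
  show ?thesis
    by (rule gr_homI) (use eq M.part_carrier M.a_closed ract_closed in auto)
qed

lemma gr_iso_bij:
  assumes "h \<in> gr_iso S M N"
  shows "bij_betw h (carrier M) (carrier N)"
proof -
  from assms obtain g where h: "h \<in> gr_hom S M N" and g: "g \<in> gr_hom S N M"
    and "\<And>x. x \<in> carrier M \<Longrightarrow> g (h x) = x" "\<And>y. y \<in> carrier N \<Longrightarrow> h (g y) = y"
    by (auto simp: gr_iso_def)
  then show ?thesis
    by (intro bij_betw_byWitness[where f' = g]) (auto simp: gr_hom_closed)
qed

section \<open>Categories of matrix factorizations\<close>

lemma is_nmfD:
  assumes "is_nmf K S d f X"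
  shows "graded_right_module K S (fmod X i)"
    and "fmap X i \<in> gr_hom S (fmod X (i + 1)) (fmod X i)"
  using assms by (auto simp: is_nmf_def)

lemma nmf_homD:
  assumes "\<mu> \<in> nmf_hom S X Y"
  shows "\<mu> i \<in> gr_hom S (fmod X i) (fmod Y i)"
    and "x \<in> carrier (fmod X (i + 1)) \<Longrightarrow> \<mu> i (fmap X i x) = fmap Y i (\<mu> (i + 1) x)"
  using assms by (auto simp: nmf_hom_def)

text \<open>Homomorphisms are extensional and \<open>compose\<close> restricts to the carrier, so
  the category laws hold as equalities of functions.\<close>

lemma NMF_cat: "cat (NMF K S d f)"
proof
  fix X assume "X \<in> Ob (NMF K S d f)"
  then have X: "is_nmf K S d f X" by (simp add: NMF_def)
  show "Id (NMF K S d f) X \<in> Hom (NMF K S d f) X X"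
    using gr_hom_identity[OF is_nmfD(1)[OF X] is_nmfD(1)[OF X]] gr_hom_closed[OF is_nmfD(2)[OF X]]
    by (simp add: NMF_def nmf_hom_def)
next
  fix X Y Z \<nu> \<mu>
  assume "X \<in> Ob (NMF K S d f)" "\<nu> \<in> Hom (NMF K S d f) Y Z" "\<mu> \<in> Hom (NMF K S d f) X Y"
  then have X: "is_nmf K S d f X" and \<nu>: "\<nu> \<in> nmf_hom S Y Z" and \<mu>: "\<mu> \<in> nmf_hom S X Y"
    by (simp_all add: NMF_def)
  have "compose (carrier (fmod X i)) (\<nu> i) (\<mu> i) \<in> gr_hom S (fmod X i) (fmod Z i)" for i
    using is_nmfD(1)[OF X] nmf_homD(1)[OF \<mu>] nmf_homD(1)[OF \<nu>] by (rule gr_hom_compose)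
  then show "Comp (NMF K S d f) X Y Z \<nu> \<mu> \<in> Hom (NMF K S d f) X Z"
    using gr_hom_closed[OF is_nmfD(2)[OF X]] gr_hom_closed[OF nmf_homD(1)[OF \<mu>]]
    by (auto simp: NMF_def nmf_hom_def compose_eq nmf_homD(2)[OF \<mu>] nmf_homD(2)[OF \<nu>])
next
  fix X Y \<mu>
  assume "\<mu> \<in> Hom (NMF K S d f) X Y"
  then have \<mu>: "\<mu> \<in> nmf_hom S X Y" by (simp add: NMF_def)
  note ex = gr_hom_extensional[OF nmf_homD(1)[OF \<mu>]]
  show "Comp (NMF K S d f) X X Y \<mu> (Id (NMF K S d f) X) = \<mu>"
    using ex by (auto simp: NMF_def compose_def fun_eq_iff extensional_def)
  show "Comp (NMF K S d f) X Y Y (Id (NMF K S d f) Y) \<mu> = \<mu>"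
    using ex gr_hom_closed[OF nmf_homD(1)[OF \<mu>]]
    by (auto simp: NMF_def compose_def fun_eq_iff extensional_def)
next
  fix W X Y Z \<nu> \<mu> \<rho>
  assume "\<rho> \<in> Hom (NMF K S d f) W X"
  then have \<rho>: "\<rho> \<in> nmf_hom S W X" by (simp add: NMF_def)
  show "Comp (NMF K S d f) W X Z (Comp (NMF K S d f) X Y Z \<nu> \<mu>) \<rho>
      = Comp (NMF K S d f) W Y Z \<nu> (Comp (NMF K S d f) W X Y \<mu> \<rho>)"
    using gr_hom_closed[OF nmf_homD(1)[OF \<rho>]]
    by (auto simp: NMF_def compose_def fun_eq_iff)
qed

section \<open>Twisting\<close>

lemma twist_module_simps [simp]:
  "carrier (twist_module \<theta> M) = carrier M" "add (twist_module \<theta> M) = add M"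
  "zero (twist_module \<theta> M) = zero M" "mpart (twist_module \<theta> M) = mpart M"
  by (simp_all add: twist_module_def)

text \<open>The product of \<open>T\<close> is pinned down on the carrier by additivity and its
  values at homogeneous left factors, not by the record \<open>twist_algebra \<theta> S\<close>. In
  this form the assumptions survive the exchange of \<open>S\<close>, \<open>\<theta>\<close> with
  \<open>T\<close>, \<open>\<theta>'\<close>.\<close>

locale twist_pair = graded_algebra K S
  for K :: "('k, 'c) ring_scheme" and S :: "('k, 'a) gr_algebra" +
  fixes T :: "('k, 'a) gr_algebra" and \<theta> \<theta>' :: "int \<Rightarrow> 'a \<Rightarrow> 'a"
  assumes T_eq: "T = S\<lparr>mult := mult T\<rparr>"
    and twisting: "twisting_system K S \<theta>"
    and inverse_closed: "a \<in> carrier S \<Longrightarrow> \<theta>' i a \<in> carrier S"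
    and twist_inverse: "a \<in> carrier S \<Longrightarrow> \<theta> i (\<theta>' i a) = a"
    and inverse_twist: "a \<in> carrier S \<Longrightarrow> \<theta>' i (\<theta> i a) = a"
    and mult_closed_T: "\<lbrakk>a \<in> carrier S; b \<in> carrier S\<rbrakk> \<Longrightarrow> a \<otimes>\<^bsub>T\<^esub> b \<in> carrier S"
    and l_distr_T: "\<lbrakk>a \<in> carrier S; b \<in> carrier S; c \<in> carrier S\<rbrakk>
      \<Longrightarrow> (a \<oplus>\<^bsub>S\<^esub> b) \<otimes>\<^bsub>T\<^esub> c = a \<otimes>\<^bsub>T\<^esub> c \<oplus>\<^bsub>S\<^esub> b \<otimes>\<^bsub>T\<^esub> c"
    and mult_T: "\<lbrakk>a \<in> part S i; b \<in> carrier S\<rbrakk> \<Longrightarrow> a \<otimes>\<^bsub>T\<^esub> b = a \<otimes>\<^bsub>S\<^esub> \<theta> i b"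
begin

lemma T_simps [simp]:
  "carrier T = carrier S" "add T = add S" "zero T = zero S" "one T = one S"
  "smult T = smult S" "part T = part S"
  using T_eq[THEN arg_cong[where f = carrier]] T_eq[THEN arg_cong[where f = add]]
    T_eq[THEN arg_cong[where f = zero]] T_eq[THEN arg_cong[where f = one]]
    T_eq[THEN arg_cong[where f = smult]] T_eq[THEN arg_cong[where f = part]]
  by simp_all

lemma twist_closed: "a \<in> carrier S \<Longrightarrow> \<theta> i a \<in> carrier S"
  and twist_add: "a \<in> carrier S \<Longrightarrow> b \<in> carrier S \<Longrightarrow> \<theta> i (a \<oplus>\<^bsub>S\<^esub> b) = \<theta> i a \<oplus>\<^bsub>S\<^esub> \<theta> i b"
  and twist_smult: "c \<in> carrier K \<Longrightarrow> a \<in> carrier S \<Longrightarrow> \<theta> i (c \<odot>\<^bsub>S\<^esub> a) = c \<odot>\<^bsub>S\<^esub> \<theta> i a"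
  and twist_part_eq: "\<theta> i ` part S j = part S j"
  using twisting bij_betw_apply[of "\<theta> i" "carrier S" "carrier S" a]
  by (simp_all add: twisting_system_def graded_linear_automorphism_def)

lemma twist_part: "a \<in> part S j \<Longrightarrow> \<theta> i a \<in> part S j"
  using twist_part_eq[of i j] by auto

lemma twist_mult:
  "a \<in> part S j \<Longrightarrow> b \<in> carrier S \<Longrightarrow> \<theta> i (a \<otimes>\<^bsub>S\<^esub> \<theta> j b) = \<theta> i a \<otimes>\<^bsub>S\<^esub> \<theta> (i + j) b"
  and twist_0: "a \<in> carrier S \<Longrightarrow> \<theta> 0 a = a"
  using twisting by (auto simp: twisting_system_def)

text \<open>Take the left factor 1, of degree 0, in the twisting identity and let the right factor
  be the preimage of 1 under \<open>\<theta> i\<close>: the identity becomes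
  \<open>\<theta> i\<close> 1 times 1 equals 1.\<close>

lemma twist_one: "\<theta> i \<one>\<^bsub>S\<^esub> = \<one>\<^bsub>S\<^esub>"
proof -
  have "\<theta> i \<one>\<^bsub>S\<^esub> \<otimes>\<^bsub>S\<^esub> \<theta> i (\<theta>' i \<one>\<^bsub>S\<^esub>) = \<theta> i (\<one>\<^bsub>S\<^esub> \<otimes>\<^bsub>S\<^esub> \<theta> 0 (\<theta>' i \<one>\<^bsub>S\<^esub>))"
    using twist_mult[of "\<one>\<^bsub>S\<^esub>" 0 "\<theta>' i \<one>\<^bsub>S\<^esub>" i] part_one inverse_closed by simp
  then show ?thesis
    using inverse_closed twist_closed by (simp add: twist_0 twist_inverse)
qed

lemma inverse_eqI: "\<lbrakk>a \<in> carrier S; \<theta> i a = b\<rbrakk> \<Longrightarrow> \<theta>' i b = a"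
  using inverse_twist by blast

lemma inverse_add:
  "a \<in> carrier S \<Longrightarrow> b \<in> carrier S \<Longrightarrow> \<theta>' i (a \<oplus>\<^bsub>S\<^esub> b) = \<theta>' i a \<oplus>\<^bsub>S\<^esub> \<theta>' i b"
  by (rule inverse_eqI) (simp_all add: inverse_closed twist_add twist_inverse)

lemma inverse_smult:
  "c \<in> carrier K \<Longrightarrow> a \<in> carrier S \<Longrightarrow> \<theta>' i (c \<odot>\<^bsub>S\<^esub> a) = c \<odot>\<^bsub>S\<^esub> \<theta>' i a"
  by (rule inverse_eqI) (simp_all add: inverse_closed twist_smult twist_inverse)

lemma inverse_part:
  assumes "a \<in> part S j"
  shows "\<theta>' i a \<in> part S j"
proof -
  from assms obtain b where b: "b \<in> part S j" "a = \<theta> i b"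
    using twist_part_eq[of i j] by (metis imageE)
  then show ?thesis
    by (simp add: inverse_twist S.part_carrier[OF b(1)])
qed

text \<open>Apply \<open>\<theta> i\<close> to the right side: \<open>\<theta>' i a\<close> has
  degree \<open>j\<close>, so the product in \<open>T\<close> inserts \<open>\<theta> j\<close>, and
  the twisting identity turns this into \<open>\<theta> (i + j)\<close>, which cancels
  \<open>\<theta>' (i + j)\<close>.\<close>

lemma inverse_mult:
  assumes a: "a \<in> part S j" and b: "b \<in> carrier S"
  shows "\<theta>' i (a \<otimes>\<^bsub>S\<^esub> b) = \<theta>' i a \<otimes>\<^bsub>T\<^esub> \<theta>' (i + j) b"
proof (rule inverse_eqI)
  have c: "\<theta>' i a \<in> carrier S" "\<theta>' (i + j) b \<in> carrier S"
    using a b S.part_carrier inverse_closed by blast+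
  then show "\<theta>' i a \<otimes>\<^bsub>T\<^esub> \<theta>' (i + j) b \<in> carrier S"
    by (rule mult_closed_T)
  show "\<theta> i (\<theta>' i a \<otimes>\<^bsub>T\<^esub> \<theta>' (i + j) b) = a \<otimes>\<^bsub>S\<^esub> b"
    using b c S.part_carrier[OF a]
    by (simp add: mult_T[OF inverse_part[OF a]] twist_mult[OF inverse_part[OF a]] twist_inverse)
qed

section \<open>The twisted action on a module\<close>

context
  fixes M :: "('a, 'm) gr_module"
  assumes M: "graded_right_module K S M"
begin

interpretation M: graded_right_module K S M
  by (rule M)

abbreviation (input) twM where "twM \<equiv> twist_module \<theta> M"

text \<open>These are the two hypotheses on \<open>g\<close> under which additive extensions were
  studied.\<close>

lemma ract_twist_action:
  assumes "a \<in> carrier S"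
  shows "\<And>i x. x \<in> mpart M i \<Longrightarrow> ract M x (\<theta> i a) \<in> carrier M"
    and "\<And>i x y. \<lbrakk>x \<in> mpart M i; y \<in> mpart M i\<rbrakk>
      \<Longrightarrow> ract M (x \<oplus>\<^bsub>M\<^esub> y) (\<theta> i a) = ract M x (\<theta> i a) \<oplus>\<^bsub>M\<^esub> ract M y (\<theta> i a)"
  using assms by (simp_all add: M.ract_closed M.ract_l_distr twist_closed M.M.part_carrier)

lemma ract_twist_closed:
  assumes x: "x \<in> carrier M" and a: "a \<in> carrier S"
  shows "ract twM x a \<in> carrier M"
  using M.M.additive_extension_closed[where g = "\<lambda>i y. ract M y (\<theta> i a)", OF ract_twist_action[OF a] x]
  by (simp add: twist_module_def)

lemma ract_twist:
  assumes x: "x \<in> mpart M i" and a: "a \<in> carrier S"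
  shows "ract twM x a = ract M x (\<theta> i a)"
  using M.M.additive_extension_homogeneous[where g = "\<lambda>i y. ract M y (\<theta> i a)", OF ract_twist_action[OF a] x]
  by (simp add: twist_module_def)

lemma ract_twist_add:
  assumes x: "x \<in> carrier M" and y: "y \<in> carrier M" and a: "a \<in> carrier S"
  shows "ract twM (x \<oplus>\<^bsub>M\<^esub> y) a = ract twM x a \<oplus>\<^bsub>M\<^esub> ract twM y a"
  using M.M.additive_extension_add[where g = "\<lambda>i y. ract M y (\<theta> i a)", OF ract_twist_action[OF a] x y]
  by (simp add: twist_module_def)

lemma ract_twist_r_distr:
  assumes x: "x \<in> carrier M" and a: "a \<in> carrier S" and b: "b \<in> carrier S"
  shows "ract twM x (a \<oplus>\<^bsub>S\<^esub> b) = ract twM x a \<oplus>\<^bsub>M\<^esub> ract twM x b"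
  using x
proof (induction rule: M.M.homogeneous_induct)
  case (homogeneous i x)
  then show ?case
    using a b by (simp add: ract_twist twist_add twist_closed M.ract_r_distr M.M.part_carrier)
next
  case (add x y)
  then show ?case
    using a b by (simp add: ract_twist_add ract_twist_closed M.M.a_ac)
qed

text \<open>The action has a formula for homogeneous \<open>x\<close>, the product in
  \<open>T\<close> one for homogeneous \<open>a\<close>; hence an induction on each. For degrees
  \<open>i\<close> and \<open>j\<close> both sides are \<open>x\<close> acted on by
  \<open>\<theta> i a\<close> and then by \<open>\<theta> (i + j) b\<close>.\<close>

lemma ract_twist_assoc:
  assumes x: "x \<in> carrier M" and a: "a \<in> carrier S" and b: "b \<in> carrier S"
  shows "ract twM x (a \<otimes>\<^bsub>T\<^esub> b) = ract twM (ract twM x a) b"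
  using x
proof (induction rule: M.M.homogeneous_induct)
  case hom: (homogeneous i x)
  note xc = M.M.part_carrier[OF hom]
  from a show ?case
  proof (induction rule: S.homogeneous_induct)
    case (homogeneous j a)
    note ac = S.part_carrier[OF homogeneous]
    have "ract twM x (a \<otimes>\<^bsub>T\<^esub> b) = ract M x (\<theta> i (a \<otimes>\<^bsub>S\<^esub> \<theta> j b))"
      using ac b by (simp add: ract_twist[OF hom] mult_T[OF homogeneous] twist_closed)
    also have "\<dots> = ract M (ract M x (\<theta> i a)) (\<theta> (i + j) b)"
      using xc ac b by (simp add: twist_mult[OF homogeneous] M.ract_assoc twist_closed)
    \<comment> \<open>The element \<open>ract M x (\<theta> i a)\<close> has degree
      \<open>i + j\<close>, so the second twisted action uses
      \<open>\<theta> (i + j)\<close>.\<close>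
    also have "\<dots> = ract twM (ract twM x a) b"
      using ac b
      by (simp add: ract_twist[OF hom] ract_twist[OF M.mpart_ract[OF hom twist_part[OF homogeneous]]])
    finally show ?case .
  next
    case (add a c)
    then show ?case
      using xc b
      by (simp add: l_distr_T mult_closed_T ract_twist_r_distr ract_twist_add ract_twist_closed)
  qed
next
  case (add x y)
  then show ?case
    using a b by (simp add: ract_twist_add ract_twist_closed mult_closed_T)
qed

lemma ract_twist_one:
  assumes "x \<in> carrier M"
  shows "ract twM x \<one>\<^bsub>S\<^esub> = x"
  using assms
proof (induction rule: M.M.homogeneous_induct)
  case (homogeneous i x)
  then show ?case by (simp add: ract_twist twist_one M.ract_one M.M.part_carrier)
next
  case (add x y)
  then show ?case by (simp add: ract_twist_add)
qed

lemma mpart_ract_twist: "x \<in> mpart M i \<Longrightarrow> a \<in> part S j \<Longrightarrow> ract twM x a \<in> mpart M (i + j)"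
  by (simp add: ract_twist S.part_carrier M.mpart_ract twist_part)

end

section \<open>The twisted algebra, twisted modules and the exchange of roles\<close>

lemma mult_T_regular:
  assumes a: "a \<in> carrier S" and b: "b \<in> carrier S"
  shows "a \<otimes>\<^bsub>T\<^esub> b = ract (twist_module \<theta> (regular_module S)) a b"
  using a
proof (induction rule: S.homogeneous_induct)
  case (homogeneous i x)
  then show ?case
    using ract_twist[OF graded_right_module_regular, of x i b] b
    by (simp add: mult_T)
next
  case (add x y)
  then show ?case
    using ract_twist_add[OF graded_right_module_regular, of x y b] b
    by (simp add: l_distr_T)
qed

lemma graded_algebra_T: "graded_algebra K T"
proof -
  have ab: "abelian_group T"
    by (rule abelian_group_cong[of _ S]) (simp_all add: ring.axioms(1)[OF ring_S])
  \<comment> \<open>The unit has degree 0, and \<open>\<theta> 0\<close> is the identity.\<close>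
  have one: "\<one>\<^bsub>S\<^esub> \<otimes>\<^bsub>T\<^esub> a = a" if "a \<in> carrier S" for a
    using that by (simp add: mult_T[OF part_one] twist_0)
  \<comment> \<open>Right distributivity, associativity and the right unit law are module laws for
    the twist of the regular module.\<close>
  have "ring T"
  proof (rule ringI[OF ab monoidI])
    fix x y z assume c: "x \<in> carrier T" "y \<in> carrier T" "z \<in> carrier T"
    show "(x \<oplus>\<^bsub>T\<^esub> y) \<otimes>\<^bsub>T\<^esub> z = x \<otimes>\<^bsub>T\<^esub> z \<oplus>\<^bsub>T\<^esub> y \<otimes>\<^bsub>T\<^esub> z"
      using c by (simp add: l_distr_T)
    show "z \<otimes>\<^bsub>T\<^esub> (x \<oplus>\<^bsub>T\<^esub> y) = z \<otimes>\<^bsub>T\<^esub> x \<oplus>\<^bsub>T\<^esub> z \<otimes>\<^bsub>T\<^esub> y"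
      using c ract_twist_r_distr[OF graded_right_module_regular, of z x y] by (simp add: mult_T_regular)
    show "x \<otimes>\<^bsub>T\<^esub> y \<otimes>\<^bsub>T\<^esub> z = x \<otimes>\<^bsub>T\<^esub> (y \<otimes>\<^bsub>T\<^esub> z)"
      using c ract_twist_assoc[OF graded_right_module_regular, of x y z] mult_closed_T[of x y]
        mult_closed_T[of y z] by (simp add: mult_T_regular)
    show "x \<otimes>\<^bsub>T\<^esub> \<one>\<^bsub>T\<^esub> = x"
      using c ract_twist_one[OF graded_right_module_regular, of x] by (simp add: mult_T_regular)
  qed (use one mult_closed_T in auto)
  moreover have "module K T"
    by (rule moduleI)
      (use ab V.smult_l_distr V.smult_r_distr V.smult_assoc1 V.is_cring in auto)
  moreover have "(c \<odot>\<^bsub>S\<^esub> a) \<otimes>\<^bsub>T\<^esub> b = c \<odot>\<^bsub>S\<^esub> (a \<otimes>\<^bsub>T\<^esub> b)"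
    if c: "c \<in> carrier K" and a: "a \<in> carrier S" and b: "b \<in> carrier S" for a b c
    using a
  proof (induction rule: S.homogeneous_induct)
    case (homogeneous i a)
    then show ?case
      using b c by (simp add: mult_T[OF part_smult] mult_T smult_mult S.part_carrier twist_closed)
  next
    case (add x y)
    then show ?case
      using b c by (simp add: V.smult_r_distr l_distr_T mult_closed_T)
  qed
  moreover have "a \<otimes>\<^bsub>T\<^esub> (c \<odot>\<^bsub>S\<^esub> b) = c \<odot>\<^bsub>S\<^esub> (a \<otimes>\<^bsub>T\<^esub> b)"
    if c: "c \<in> carrier K" and a: "a \<in> carrier S" and b: "b \<in> carrier S" for a b c
    using a
  proof (induction rule: S.homogeneous_induct)
    case (homogeneous i a)
    then show ?case
      using b c by (simp add: mult_T mult_smult twist_smult S.part_carrier twist_closed)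
  next
    case (add x y)
    then show ?case
      using b c by (simp add: V.smult_r_distr l_distr_T mult_closed_T)
  qed
  moreover have "submodule (part S i) K T" for i
    using part_submodule[of i]
    by (simp add: submodule_def submodule_axioms_def subgroup_def m_inv_def)
  moreover have "internal_direct_sum T (part S)"
    using part_direct_sum internal_direct_sum_cong[of T S] by simp
  ultimately show ?thesis
    by (intro graded_algebra.intro)
      (simp_all add: field_K part_neg part_one mult_T S.part_carrier part_mult twist_part)
qed

lemma graded_right_module_twist:
  assumes M: "graded_right_module K S M"
  shows "graded_right_module K T (twist_module \<theta> M)"
proof -
  interpret M: graded_right_module K S M by (rule M)
  have "abelian_group (twist_module \<theta> M)"
    by (rule abelian_group_cong[of _ M]) (simp_all add: M M.abelian_group_M)
  moreover have "internal_direct_sum (twist_module \<theta> M) (mpart M)"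
    using M.mpart_direct_sum internal_direct_sum_cong[of "twist_module \<theta> M" M] by (simp add: M)
  ultimately show ?thesis
    by (intro graded_right_module.intro graded_algebra_T graded_right_module_axioms.intro)
      (simp_all add: M ract_twist_closed[OF M] ract_twist_add[OF M] ract_twist_r_distr[OF M]
        ract_twist_assoc[OF M] ract_twist_one[OF M] mpart_ract_twist[OF M])
qed

text \<open>For \<open>a\<close> of degree \<open>j\<close>, multiplying \<open>a\<close> by
  \<open>\<theta>' j b\<close> in \<open>T\<close> gives the product of \<open>a\<close> and
  \<open>b\<close> in \<open>S\<close>. Hence \<open>inverse_mult\<close> is the twisting identity
  for \<open>\<theta>'\<close> on \<open>T\<close>.\<close>

lemma inverse_twist_pair: "twist_pair K T S \<theta>' \<theta>"
proof -
  have "graded_linear_automorphism K T (\<theta>' i)" for i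
  proof -
    have "bij_betw (\<theta>' i) (carrier S) (carrier S)"
      by (rule bij_betw_byWitness[where f' = "\<theta> i"])
        (auto simp: twist_inverse inverse_twist twist_closed inverse_closed)
    moreover have "\<theta>' i ` part S j = part S j" for j
    proof
      show "\<theta>' i ` part S j \<subseteq> part S j" using inverse_part by blast
      show "part S j \<subseteq> \<theta>' i ` part S j"
        using twist_part inverse_twist[OF S.part_carrier] by (metis image_eqI subsetI)
    qed
    ultimately show ?thesis
      by (simp add: graded_linear_automorphism_def inverse_add inverse_smult)
  qed
  moreover have "\<theta>' i (a \<otimes>\<^bsub>T\<^esub> \<theta>' j b) = \<theta>' i a \<otimes>\<^bsub>T\<^esub> \<theta>' (i + j) b"
    if "a \<in> part S j" "b \<in> carrier S" for i j a b
    using that inverse_mult by (simp add: mult_T inverse_closed twist_inverse)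
  moreover have "\<theta>' 0 a = a" if "a \<in> carrier S" for a
    using that by (intro inverse_eqI) (simp_all add: twist_0)
  ultimately have "twisting_system K T \<theta>'"
    by (simp add: twisting_system_def)
  moreover have "S = T\<lparr>mult := mult S\<rparr>"
    by (subst T_eq) simp
  ultimately show ?thesis
    by (intro twist_pair.intro graded_algebra_T twist_pair_axioms.intro)
      (simp_all add: twist_closed twist_inverse inverse_twist S.l_distr mult_T inverse_closed)
qed

text \<open>As \<open>h\<close> preserves degrees, the actions on a homogeneous \<open>x\<close> and
  on \<open>h x\<close> are twisted by the same \<open>\<theta> i\<close>.\<close>

lemma gr_hom_twist:
  assumes M: "graded_right_module K S M" and N: "graded_right_module K S N"
    and h: "h \<in> gr_hom S M N"
  shows "h \<in> gr_hom T (twist_module \<theta> M) (twist_module \<theta> N)"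
proof (rule gr_homI)
  interpret M: graded_right_module K S M by (rule M)
  fix x a
  assume "x \<in> carrier (twist_module \<theta> M)" and a: "a \<in> carrier T"
  then have "x \<in> carrier M" by (simp add: M)
  then show "h (ract (twist_module \<theta> M) x a) = ract (twist_module \<theta> N) (h x) a"
  proof (induction rule: M.M.homogeneous_induct)
    case (homogeneous i x)
    then show ?case
      using a by (simp add: ract_twist[OF M] ract_twist[OF N gr_hom_part[OF h]] M.M.part_carrier
        gr_hom_ract[OF h] twist_closed)
  next
    case (add x y)
    then show ?case
      using a by (simp add: ract_twist_add[OF M] ract_twist_add[OF N] gr_hom_closed[OF h]
        gr_hom_add[OF h] ract_twist_closed[OF M])
  qed
qed (simp_all add: M N gr_hom_closed[OF h] gr_hom_add[OF h] gr_hom_part[OF h]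
    gr_hom_extensional[OF h])

text \<open>On degree \<open>i\<close> the two twists replace \<open>a\<close> by
  \<open>\<theta> i (\<theta>' i a)\<close>, which is \<open>a\<close>.\<close>

lemma ract_twist_twist:
  assumes M: "graded_right_module K S M" and x: "x \<in> carrier M" and a: "a \<in> carrier S"
  shows "ract (twist_module \<theta>' (twist_module \<theta> M)) x a = ract M x a"
proof -
  interpret M: graded_right_module K S M by (rule M)
  note tM = graded_right_module_twist[OF M]
  from x show ?thesis
  proof (induction rule: M.M.homogeneous_induct)
    case (homogeneous i x)
    then show ?case
      using a twist_pair.ract_twist[OF inverse_twist_pair tM, of x i a]
      by (simp add: M ract_twist[OF M] inverse_closed twist_inverse)
  next
    case (add x y)
    then show ?case
      using a twist_pair.ract_twist_add[OF inverse_twist_pair tM, of x y a] by (simp add: M M.ract_l_distr)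
  qed
qed

end

section \<open>Free modules\<close>

lemma free_module_simps [simp]:
  "carrier (free_module S r n) = (\<Pi>\<^sub>E s\<in>{1..r}. carrier S)"
  "add (free_module S r n) = (\<lambda>x y. \<lambda>s\<in>{1..r}. x s \<oplus>\<^bsub>S\<^esub> y s)"
  "ract (free_module S r n) = (\<lambda>x a. \<lambda>s\<in>{1..r}. x s \<otimes>\<^bsub>S\<^esub> a)"
  "mpart (free_module S r n) = (\<lambda>i. \<Pi>\<^sub>E s\<in>{1..r}. part S (n s + i))"
  by (simp_all add: free_module_def direct_sum_module_def shift_module_def regular_module_def)

text \<open>Additivity and linearity of the inverse \<open>g\<close> follow from those of
  \<open>h\<close> by writing arguments as values of \<open>h\<close>. Closure conditions on
  \<open>N\<close> take the place of a proof that \<open>N\<close> is a graded module.\<close>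

lemma gr_isoI:
  assumes M: "graded_right_module K S M"
    and h: "h \<in> gr_hom S M N"
    and N: "\<And>x y. \<lbrakk>x \<in> carrier N; y \<in> carrier N\<rbrakk> \<Longrightarrow> x \<oplus>\<^bsub>N\<^esub> y \<in> carrier N"
      "\<And>x a. \<lbrakk>x \<in> carrier N; a \<in> carrier S\<rbrakk> \<Longrightarrow> ract N x a \<in> carrier N"
      "\<And>i. mpart N i \<subseteq> carrier N"
    and g: "\<And>y. y \<in> carrier N \<Longrightarrow> g y \<in> carrier M" "\<And>i y. y \<in> mpart N i \<Longrightarrow> g y \<in> mpart M i"
    and gh: "\<And>x. x \<in> carrier M \<Longrightarrow> g (h x) = x"
    and hg: "\<And>y. y \<in> carrier N \<Longrightarrow> h (g y) = y"
  shows "h \<in> gr_iso S M N"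
proof -
  interpret M: graded_right_module K S M by (rule M)
  have "restrict g (carrier N) \<in> gr_hom S N M"
  proof (rule gr_homI)
    fix x y assume xy: "x \<in> carrier N" "y \<in> carrier N"
    then have "g (x \<oplus>\<^bsub>N\<^esub> y) = g (h (g x \<oplus>\<^bsub>M\<^esub> g y))"
      by (simp add: gr_hom_add[OF h] g(1) hg)
    then show "restrict g (carrier N) (x \<oplus>\<^bsub>N\<^esub> y)
        = restrict g (carrier N) x \<oplus>\<^bsub>M\<^esub> restrict g (carrier N) y"
      using xy by (simp add: gh g(1) N(1))
  next
    fix x a assume xa: "x \<in> carrier N" "a \<in> carrier S"
    then have "g (ract N x a) = g (h (ract M (g x) a))"
      by (simp add: gr_hom_ract[OF h] g(1) hg)
    then show "restrict g (carrier N) (ract N x a) = ract M (restrict g (carrier N) x) a"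
      using xa by (simp add: gh g(1) N(2) M.ract_closed)
  qed (use g N(3)[THEN subsetD] in auto)
  then show ?thesis
    unfolding gr_iso_def using h gh hg gr_hom_closed[OF h]
    by (intro CollectI conjI bexI[of _ "restrict g (carrier N)"]) auto
qed

context twist_pair
begin

lemma unit_smult_cancel:
  assumes "c \<in> Units K" and "a \<in> carrier S"
  shows "(inv\<^bsub>K\<^esub> c) \<odot>\<^bsub>S\<^esub> (c \<odot>\<^bsub>S\<^esub> a) = a" "c \<odot>\<^bsub>S\<^esub> ((inv\<^bsub>K\<^esub> c) \<odot>\<^bsub>S\<^esub> a) = a"
  using assms by (simp_all add: V.Units_closed flip: V.smult_assoc1)

text \<open>For \<open>x\<close> homogeneous of degree \<open>i\<close> in \<open>S(n)\<close>, that is, of degree \<open>n + i\<close> in \<open>S\<close>, the twisting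
  identity reads \<open>\<theta>\<^sub>-\<^sub>n (x \<theta>\<^sub>n\<^sub>+\<^sub>i a) = \<theta>\<^sub>-\<^sub>n x \<theta>\<^sub>i a\<close>, so \<open>\<theta>\<^sub>-\<^sub>n\<close> is an isomorphism from the shift of the
  twist to the twist of the shift. Its inverse is used here, rescaled by units.\<close>

lemma gr_iso_free_twist:
  assumes M: "graded_right_module K S M" and h: "h \<in> gr_iso S M (free_module S r n)"
    and c: "\<And>s. c s \<in> Units K"
  shows "(\<lambda>x\<in>carrier M. \<lambda>s\<in>{1..r}. c s \<odot>\<^bsub>S\<^esub> \<theta>' (- n s) (h x s))
    \<in> gr_iso T (twist_module \<theta> M) (free_module T r n)"
    (is "?h \<in> _")
proof -
  interpret M: graded_right_module K S M by (rule M)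
  have c': "c s \<in> carrier K" "inv\<^bsub>K\<^esub> (c s) \<in> carrier K" for s
    using c by (simp_all add: V.Units_closed)
  from h obtain g where hom: "h \<in> gr_hom S M (free_module S r n)"
    and g: "g \<in> gr_hom S (free_module S r n) M"
    and gh: "\<And>x. x \<in> carrier M \<Longrightarrow> g (h x) = x"
    and hg: "\<And>y. y \<in> (\<Pi>\<^sub>E s\<in>{1..r}. carrier S) \<Longrightarrow> h (g y) = y"
    by (auto simp: gr_iso_def)
  have hc: "h x \<in> (\<Pi>\<^sub>E s\<in>{1..r}. carrier S)" if "x \<in> carrier M" for x
    using gr_hom_closed[OF hom that] by simp
  have hs: "h x s \<in> carrier S" if "x \<in> carrier M" "s \<in> {1..r}" for x s
    using hc[OF that(1)] that(2) by (rule PiE_mem)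
  have hp: "h x s \<in> part S (n s + i)" if "x \<in> mpart M i" "s \<in> {1..r}" for x s i
    using gr_hom_part[OF hom that(1)] that(2) by (simp add: PiE_iff)
  \<comment> \<open>The coordinatewise inverse of the rescaled \<open>\<theta>' (- n s)\<close>;
    following it by \<open>g\<close> inverts the whole map.\<close>
  define u where "u y = (\<lambda>s\<in>{1..r}. \<theta> (- n s) ((inv\<^bsub>K\<^esub> (c s)) \<odot>\<^bsub>S\<^esub> y s))" for y
  have uc: "u y \<in> (\<Pi>\<^sub>E s\<in>{1..r}. carrier S)" if "y \<in> (\<Pi>\<^sub>E s\<in>{1..r}. carrier S)" for y
    using that by (simp add: PiE_iff u_def twist_closed c')
  have up: "u y \<in> (\<Pi>\<^sub>E s\<in>{1..r}. part S (n s + i))" if "y \<in> (\<Pi>\<^sub>E s\<in>{1..r}. part S (n s + i))" for y i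
    using that by (simp add: PiE_iff u_def twist_part part_smult c')
  show ?thesis
  proof (rule gr_isoI[where g = "\<lambda>y. g (u y)"])
    show "graded_right_module K T (twist_module \<theta> M)"
      by (rule graded_right_module_twist[OF M])
    show "?h \<in> gr_hom T (twist_module \<theta> M) (free_module T r n)"
    proof (rule gr_homI)
      fix x y assume "x \<in> carrier (twist_module \<theta> M)" "y \<in> carrier (twist_module \<theta> M)"
      then show "?h (x \<oplus>\<^bsub>twist_module \<theta> M\<^esub> y) = ?h x \<oplus>\<^bsub>free_module T r n\<^esub> ?h y"
        by (simp add: gr_hom_add[OF hom] inverse_add hs inverse_closed c' V.smult_r_distr
            cong: restrict_cong)
    next
      fix x a assume x: "x \<in> carrier (twist_module \<theta> M)" and "a \<in> carrier T"
      then have a: "a \<in> carrier S" by simp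
      have "x \<in> carrier M" using x by simp
      then have "c s \<odot>\<^bsub>S\<^esub> \<theta>' (- n s) (h (ract (twist_module \<theta> M) x a) s)
          = (c s \<odot>\<^bsub>S\<^esub> \<theta>' (- n s) (h x s)) \<otimes>\<^bsub>T\<^esub> a" if s: "s \<in> {1..r}" for s
      proof (induction rule: M.M.homogeneous_induct)
        case (homogeneous i x)
        note xc = M.M.part_carrier[OF homogeneous]
        note p = hp[OF homogeneous s]
        \<comment> \<open>Here \<open>h x s\<close> has degree \<open>n s + i\<close> in
          \<open>S\<close>, so \<open>inverse_mult\<close> at index \<open>- n s\<close> puts
          \<open>\<theta>' i\<close> on the right factor, cancelling
          \<open>\<theta> i\<close>.\<close>
        have "\<theta>' (- n s) (h x s \<otimes>\<^bsub>S\<^esub> \<theta> i a) = \<theta>' (- n s) (h x s) \<otimes>\<^bsub>T\<^esub> a"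
          using a by (simp add: inverse_mult[OF p] twist_closed inverse_twist)
        then show ?case
          using a xc s
          by (simp add: ract_twist[OF M homogeneous] gr_hom_ract[OF hom] twist_closed
              graded_algebra.smult_mult[OF graded_algebra_T, simplified] c' hs inverse_closed)
      next
        case (add x y)
        then show ?case
          using a s
          by (simp add: ract_twist_add[OF M] ract_twist_closed[OF M] gr_hom_add[OF hom] hs
              inverse_add inverse_closed c' V.smult_r_distr l_distr_T)
      qed
      then show "?h (ract (twist_module \<theta> M) x a) = ract (free_module T r n) (?h x) a"
        using x a by (simp add: ract_twist_closed[OF M] cong: restrict_cong)
    next
      fix i x assume "x \<in> mpart (twist_module \<theta> M) i"
      then have x: "x \<in> mpart M i" by simp
      show "?h x \<in> mpart (free_module T r n) i"
        using M.M.part_carrier[OF x] hp[OF x]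
        by (auto intro!: part_smult c' inverse_part)
    qed (auto intro!: inverse_closed hs c')
    show "?h (g (u y)) = y" if "y \<in> carrier (free_module T r n)" for y
    proof -
      have y: "y \<in> (\<Pi>\<^sub>E s\<in>{1..r}. carrier S)" using that by simp
      then have "y s \<in> carrier S" if "s \<in> {1..r}" for s
        using that by (rule PiE_mem)
      then have "?h (g (u y)) = restrict y {1..r}"
        using gr_hom_closed[OF g, of "u y"] uc[OF y]
        by (simp add: hg u_def inverse_twist c' unit_smult_cancel[OF c] cong: restrict_cong)
      then show ?thesis using y by (simp add: PiE_restrict)
    qed
    show "g (u (?h x)) = x" if "x \<in> carrier (twist_module \<theta> M)" for x
    proof -
      have x: "x \<in> carrier M" using that by simp
      have "u (?h x) = restrict (h x) {1..r}"
        using x by (simp add: u_def hs unit_smult_cancel[OF c] inverse_closed twist_inverse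
            cong: restrict_cong)
      then show ?thesis using hc[OF x] gh[OF x] by (simp add: PiE_restrict)
    qed
    show "g (u y) \<in> carrier (twist_module \<theta> M)" if "y \<in> carrier (free_module T r n)" for y
      using that uc gr_hom_closed[OF g, of "u y"] by simp
    show "g (u y) \<in> mpart (twist_module \<theta> M) i" if "y \<in> mpart (free_module T r n) i" for y i
      using that up gr_hom_part[OF g, of "u y"] by simp
    show "mpart (free_module T r n) i \<subseteq> carrier (free_module T r n)" for i
      using S.part_carrier by (simp add: PiE_mono subsetI)
  qed (simp_all add: PiE_iff mult_closed_T)
qed

section \<open>Twisting matrix factorizations\<close>

lemma twist_factorization_simps [simp]:
  "fmod (twist_factorization \<theta> X) i = twist_module \<theta> (fmod X i)"
  "fmap (twist_factorization \<theta> X) i = fmap X i"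
  by (simp_all add: twist_factorization_def twist_map_def)

text \<open>The eigenvalues enter as unspecified units, a form that passes to the inverse family
  with inverse units.\<close>

context
  fixes f :: 'a and d :: nat
  assumes f: "f \<in> part S (int d)"
    and eigen: "\<And>i. \<exists>c\<in>Units K. \<theta> i f = c \<odot>\<^bsub>S\<^esub> f"
begin

lemma is_nmf_twist:
  assumes X: "is_nmf K S d f X"
  shows "is_nmf K T d f (twist_factorization \<theta> X)"
proof -
  note M = is_nmfD(1)[OF X]
  have one: "\<one>\<^bsub>K\<^esub> \<in> Units K"
    by simp
  from eigen obtain c where c: "\<And>i. c i \<in> Units K" "\<And>i. \<theta> i f = c i \<odot>\<^bsub>S\<^esub> f"
    by metis
  have c': "c s \<in> carrier K" "inv\<^bsub>K\<^esub> (c s) \<in> carrier K" "inv\<^bsub>K\<^esub> (c s) \<in> Units K" for s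
    using c(1) by (simp_all add: V.Units_closed)
  have fc: "f \<in> carrier S" using f by (rule S.part_carrier)
  from X obtain r m where free: "\<And>i. graded_free S r (fmod X i)"
    and m: "\<And>i s. s \<in> {1..r} \<Longrightarrow> m (i + 2) s = m i s + int d"
    and ab: "\<And>i. \<exists>\<alpha>\<in>gr_iso S (fmod X (i + 2)) (free_module S r (\<lambda>s. - m i s - int d)).
        \<exists>\<beta>\<in>gr_iso S (fmod X i) (free_module S r (\<lambda>s. - m i s)).
          \<forall>x\<in>carrier (fmod X (i + 2)). \<beta> (fmap X i (fmap X (i + 1) x)) = left_mult S r f (\<alpha> x)"
    unfolding is_nmf_def by blast
  \<comment> \<open>Freeness survives with the same shifts, using the isomorphism with all scalars
    1.\<close>
  have "graded_free T r (twist_module \<theta> (fmod X i))" for i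
    using free[of i] gr_iso_free_twist[OF M, of _ i r _ "\<lambda>_. \<one>\<^bsub>K\<^esub>"] one
    unfolding graded_free_def by blast
  moreover have "\<exists>\<alpha>\<in>gr_iso T (twist_module \<theta> (fmod X (i + 2))) (free_module T r (\<lambda>s. - m i s - int d)).
        \<exists>\<beta>\<in>gr_iso T (twist_module \<theta> (fmod X i)) (free_module T r (\<lambda>s. - m i s)).
          \<forall>x\<in>carrier (fmod X (i + 2)). \<beta> (fmap X i (fmap X (i + 1) x)) = left_mult T r f (\<alpha> x)" for i
  proof -
    from ab[of i] obtain \<alpha> \<beta>
      where \<alpha>: "\<alpha> \<in> gr_iso S (fmod X (i + 2)) (free_module S r (\<lambda>s. - m i s - int d))"
        and \<beta>: "\<beta> \<in> gr_iso S (fmod X i) (free_module S r (\<lambda>s. - m i s))"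
        and eq: "\<And>x. x \<in> carrier (fmod X (i + 2))
          \<Longrightarrow> \<beta> (fmap X i (fmap X (i + 1) x)) = left_mult S r f (\<alpha> x)"
      by blast
    \<comment> \<open>The scalar cancels the eigenvalue of \<open>f\<close> under
      \<open>\<theta> (m i s)\<close>; only the source is rescaled, and the target keeps the scalar
      1.\<close>
    let ?\<alpha> = "\<lambda>x\<in>carrier (fmod X (i + 2)). \<lambda>s\<in>{1..r}.
      (inv\<^bsub>K\<^esub> (c (m i s))) \<odot>\<^bsub>S\<^esub> \<theta>' (- (- m i s - int d)) (\<alpha> x s)"
    let ?\<beta> = "\<lambda>x\<in>carrier (fmod X i). \<lambda>s\<in>{1..r}. \<one>\<^bsub>K\<^esub> \<odot>\<^bsub>S\<^esub> \<theta>' (- (- m i s)) (\<beta> x s)"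
    have \<alpha>': "?\<alpha> \<in> gr_iso T (twist_module \<theta> (fmod X (i + 2)))
        (free_module T r (\<lambda>s. - m i s - int d))"
      by (rule gr_iso_free_twist[OF M \<alpha>]) (rule c'(3))
    have \<beta>': "?\<beta> \<in> gr_iso T (twist_module \<theta> (fmod X i)) (free_module T r (\<lambda>s. - m i s))"
      by (rule gr_iso_free_twist[OF M \<beta>]) (rule one)
    have "?\<beta> (fmap X i (fmap X (i + 1) x)) = left_mult T r f (?\<alpha> x)"
      if x: "x \<in> carrier (fmod X (i + 2))" for x
    proof -
      \<comment> \<open>The map \<open>?\<beta>\<close> is restricted to the carrier, so the double
        image must be placed there before it can be unfolded.\<close>
      have "fmap X (i + 1) x \<in> carrier (fmod X (i + 1))"
        using gr_hom_closed[OF is_nmfD(2)[OF X, of "i + 1"], of x] x by (simp add: add.assoc)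
      then have xx: "fmap X i (fmap X (i + 1) x) \<in> carrier (fmod X i)"
        by (rule gr_hom_closed[OF is_nmfD(2)[OF X]])
      have "\<theta>' (m i s) (f \<otimes>\<^bsub>S\<^esub> \<alpha> x s)
          = f \<otimes>\<^bsub>T\<^esub> ((inv\<^bsub>K\<^esub> (c (m i s))) \<odot>\<^bsub>S\<^esub> \<theta>' (m i s + int d) (\<alpha> x s))"
        and "f \<otimes>\<^bsub>S\<^esub> \<alpha> x s \<in> carrier S"
        and "f \<otimes>\<^bsub>T\<^esub> ((inv\<^bsub>K\<^esub> (c (m i s))) \<odot>\<^bsub>S\<^esub> \<theta>' (m i s + int d) (\<alpha> x s)) \<in> carrier S"
        if s: "s \<in> {1..r}" for s
      proof -
        have "\<alpha> x \<in> (\<Pi>\<^sub>E s\<in>{1..r}. carrier S)"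
          using bij_betw_apply[OF gr_iso_bij[OF \<alpha>] x] by simp
        then have y: "\<alpha> x s \<in> carrier S" using s by (rule PiE_mem)
        then show "f \<otimes>\<^bsub>S\<^esub> \<alpha> x s \<in> carrier S" using fc by simp
        let ?z = "(inv\<^bsub>K\<^esub> (c (m i s))) \<odot>\<^bsub>S\<^esub> \<theta>' (m i s + int d) (\<alpha> x s)"
        have z: "?z \<in> carrier S" using y by (simp add: c' inverse_closed)
        show Tz: "f \<otimes>\<^bsub>T\<^esub> ?z \<in> carrier S" using fc z by (rule mult_closed_T)
        show "\<theta>' (m i s) (f \<otimes>\<^bsub>S\<^esub> \<alpha> x s) = f \<otimes>\<^bsub>T\<^esub> ?z"
        proof (rule inverse_eqI)
          show "f \<otimes>\<^bsub>T\<^esub> ?z \<in> carrier S" by (rule Tz)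
          \<comment> \<open>As \<open>f\<close> has degree \<open>d\<close>, the product in
            \<open>T\<close> inserts \<open>\<theta>\<close> at \<open>int d\<close>, and the
            twisting identity raises this index to \<open>m i s + int d\<close>, the one inverted in
            \<open>?\<alpha>\<close>.\<close>
          have "\<theta> (m i s) (f \<otimes>\<^bsub>T\<^esub> ?z) = (c (m i s) \<odot>\<^bsub>S\<^esub> f) \<otimes>\<^bsub>S\<^esub> \<theta> (m i s + int d) ?z"
            using z by (simp add: mult_T[OF f] twist_mult[OF f] c(2))
          also have "\<theta> (m i s + int d) ?z = (inv\<^bsub>K\<^esub> (c (m i s))) \<odot>\<^bsub>S\<^esub> \<alpha> x s"
            using y by (simp add: twist_smult c' inverse_closed twist_inverse)
          also have "(c (m i s) \<odot>\<^bsub>S\<^esub> f) \<otimes>\<^bsub>S\<^esub> \<dots> = f \<otimes>\<^bsub>S\<^esub> \<alpha> x s"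
            using y fc c' by (simp add: smult_mult mult_smult unit_smult_cancel[OF c(1)])
          finally show "\<theta> (m i s) (f \<otimes>\<^bsub>T\<^esub> ?z) = f \<otimes>\<^bsub>S\<^esub> \<alpha> x s" .
        qed
      qed
      then show ?thesis
        using x xx by (simp add: eq[OF x] left_mult_def add.commute[of "int d"] cong: restrict_cong)
    qed
    with \<alpha>' \<beta>' show ?thesis by blast
  qed
  ultimately show ?thesis
    unfolding is_nmf_def
    using graded_right_module_twist[OF M] gr_hom_twist[OF M M is_nmfD(2)[OF X]] m
    by (intro conjI allI exI[of _ r] exI[of _ m]) simp_all
qed

lemma nmf_hom_twist:
  assumes "is_nmf K S d f X" "is_nmf K S d f Y" "\<mu> \<in> nmf_hom S X Y"
  shows "\<mu> \<in> nmf_hom T (twist_factorization \<theta> X) (twist_factorization \<theta> Y)"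
  using gr_hom_twist[OF is_nmfD(1)[OF assms(1)] is_nmfD(1)[OF assms(2)] nmf_homD(1)[OF assms(3)]]
    nmf_homD(2)[OF assms(3)]
  by (simp add: nmf_hom_def)

lemma twist_functor: "cat_functor (NMF K S d f) (NMF K T d f) (twist_functor \<theta>)"
  by (intro cat_functor.intro NMF_cat cat_functor_axioms.intro)
    (simp_all add: NMF_def twist_functor_def twist_map_def is_nmf_twist nmf_hom_twist)

text \<open>Twisting back and forth returns the given actions only on the carriers, where alone they
  matter; hence the identity maps are natural isomorphisms although the functors differ.\<close>

lemma twist_inverse_natural:
  "naturally_isomorphic (NMF K S d f) (NMF K S d f)
     (comp_fun (twist_functor \<theta>') (twist_functor \<theta>)) id_fun"
proof -
  let ?tt = "\<lambda>X. twist_factorization \<theta>' (twist_factorization \<theta> X)"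
  let ?id = "\<lambda>X i. \<lambda>x\<in>carrier (fmod X i). x"
  note fs = twist_factorization_def twist_map_def
  have "?id X \<in> nmf_hom S (?tt X) X" "?id X \<in> nmf_hom S X (?tt X)"
    if X: "is_nmf K S d f X" for X
  proof -
    note M = is_nmfD(1)[OF X]
    have M'': "graded_right_module K S (twist_module \<theta>' (twist_module \<theta> (fmod X i)))" for i
      by (rule twist_pair.graded_right_module_twist[OF inverse_twist_pair
            graded_right_module_twist[OF M]])
    note closed = gr_hom_closed[OF is_nmfD(2)[OF X]]
    have "?id X i \<in> gr_hom S (twist_module \<theta>' (twist_module \<theta> (fmod X i))) (fmod X i)" for i
      using gr_hom_identity[OF M'' M] ract_twist_twist[OF M] by simp
    then show "?id X \<in> nmf_hom S (?tt X) X"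
      using closed by (simp add: nmf_hom_def fs)
    have "?id X i \<in> gr_hom S (fmod X i) (twist_module \<theta>' (twist_module \<theta> (fmod X i)))" for i
      using gr_hom_identity[OF M M''] ract_twist_twist[OF M] by simp
    then show "?id X \<in> nmf_hom S X (?tt X)"
      using closed by (simp add: nmf_hom_def fs)
  qed note id = this
  \<comment> \<open>The same function serves as the inverse arrow.\<close>
  have "iso_arrow (NMF K S d f) (?tt X) X (?id X)" if "is_nmf K S d f X" for X
    unfolding iso_arrow_def using id[OF that]
    by (intro conjI bexI[of _ "?id X"]) (auto simp: NMF_def fs compose_def fun_eq_iff)
  moreover have "(\<lambda>i. compose (carrier (fmod X i)) (?id Y i) (\<mu> i))
      = (\<lambda>i. compose (carrier (fmod X i)) (\<mu> i) (?id X i))"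
    if "\<mu> \<in> nmf_hom S X Y" for X Y \<mu>
    using gr_hom_closed[OF nmf_homD(1)[OF that]] by (auto simp: compose_def fun_eq_iff)
  ultimately show ?thesis
    unfolding naturally_isomorphic_def
    by (intro exI[of _ ?id] conjI ballI)
      (simp_all add: NMF_def comp_fun_def id_fun_def twist_functor_def fs)
qed

end

end

section \<open>The twist algebra as an instance, and the equivalence\<close>

lemma (in graded_algebra) twist_algebra_twist_pair:
  assumes \<theta>: "twisting_system K S \<theta>"
  shows "twist_pair K S (twist_algebra \<theta> S) \<theta> (\<lambda>i. inv_into (carrier S) (\<theta> i))"
proof -
  have bij: "bij_betw (\<theta> i) (carrier S) (carrier S)" for i
    using \<theta> by (simp add: twisting_system_def graded_linear_automorphism_def)
  have closed: "\<theta> i a \<in> carrier S" if "a \<in> carrier S" for i a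
    using bij_betw_apply[OF bij that] .
  \<comment> \<open>The hypotheses for additive extension, with \<open>g i a\<close> the product of
    \<open>a\<close> and \<open>\<theta> i b\<close>.\<close>
  have action: "\<And>i a. a \<in> part S i \<Longrightarrow> a \<otimes>\<^bsub>S\<^esub> \<theta> i b \<in> carrier S"
    "\<And>i a a'. \<lbrakk>a \<in> part S i; a' \<in> part S i\<rbrakk>
      \<Longrightarrow> (a \<oplus>\<^bsub>S\<^esub> a') \<otimes>\<^bsub>S\<^esub> \<theta> i b = a \<otimes>\<^bsub>S\<^esub> \<theta> i b \<oplus>\<^bsub>S\<^esub> a' \<otimes>\<^bsub>S\<^esub> \<theta> i b"
    if "b \<in> carrier S" for b
    using that closed by (simp_all add: S.l_distr S.part_carrier)
  show ?thesis
  proof (intro twist_pair.intro graded_algebra_axioms twist_pair_axioms.intro \<theta>)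
    show "twist_algebra \<theta> S = S\<lparr>mult := mult (twist_algebra \<theta> S)\<rparr>"
      by (simp add: twist_algebra_def)
    fix a b i
    assume a: "a \<in> carrier S"
    show "inv_into (carrier S) (\<theta> i) a \<in> carrier S"
      using a bij_betw_imp_surj_on[OF bij, of i] by (metis inv_into_into)
    show "\<theta> i (inv_into (carrier S) (\<theta> i) a) = a"
      using a by (rule bij_betw_inv_into_right[OF bij])
    show "inv_into (carrier S) (\<theta> i) (\<theta> i a) = a"
      using a by (rule bij_betw_inv_into_left[OF bij])
  next
    fix a b
    assume a: "a \<in> carrier S" and b: "b \<in> carrier S"
    show "a \<otimes>\<^bsub>twist_algebra \<theta> S\<^esub> b \<in> carrier S"
      using S.additive_extension_closed[where g = "\<lambda>i a. a \<otimes>\<^bsub>S\<^esub> \<theta> i b", OF action[OF b] a]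
      by (simp add: twist_algebra_def)
  next
    fix a a' b
    assume a: "a \<in> carrier S" "a' \<in> carrier S" and b: "b \<in> carrier S"
    show "(a \<oplus>\<^bsub>S\<^esub> a') \<otimes>\<^bsub>twist_algebra \<theta> S\<^esub> b
        = a \<otimes>\<^bsub>twist_algebra \<theta> S\<^esub> b \<oplus>\<^bsub>S\<^esub> a' \<otimes>\<^bsub>twist_algebra \<theta> S\<^esub> b"
      using S.additive_extension_add[where g = "\<lambda>i a. a \<otimes>\<^bsub>S\<^esub> \<theta> i b", OF action[OF b] a]
      by (simp add: twist_algebra_def)
  next
    fix a b i
    assume a: "a \<in> part S i" and b: "b \<in> carrier S"
    show "a \<otimes>\<^bsub>twist_algebra \<theta> S\<^esub> b = a \<otimes>\<^bsub>S\<^esub> \<theta> i b"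
      using S.additive_extension_homogeneous[where g = "\<lambda>i a. a \<otimes>\<^bsub>S\<^esub> \<theta> i b", OF action[OF b] a]
      by (simp add: twist_algebra_def)
  qed
qed

theorem theorem1p2:
  fixes K :: "('k, 'c) ring_scheme"
    and S :: "('k, 'a) gr_algebra"
    and f :: 'a and d :: nat
    and \<theta> :: "int \<Rightarrow> 'a \<Rightarrow> 'a"
    and lam :: 'k
  assumes "graded_algebra K S"
    and "f \<in> part S (int d)" and "f \<noteq> \<zero>\<^bsub>S\<^esub>" and "d \<ge> 1"
    and "twisting_system K S \<theta>"
    and "lam \<in> carrier K" and "lam \<noteq> \<zero>\<^bsub>K\<^esub>"
    and "\<And>i :: int. \<theta> i f = (lam [^]\<^bsub>K\<^esub> i) \<odot>\<^bsub>S\<^esub> f"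
  shows "equivalence_functor
      (NMF K S d f :: (('a, 'm) factorization, int \<Rightarrow> 'm \<Rightarrow> 'm) precat)
      (NMF K (twist_algebra \<theta> S) d f)
      (twist_functor \<theta>)
    \<and> equivalent_categories
      (NMF K S d f :: (('a, 'm) factorization, int \<Rightarrow> 'm \<Rightarrow> 'm) precat)
      (NMF K (twist_algebra \<theta> S) d f :: (('a, 'm) factorization, int \<Rightarrow> 'm \<Rightarrow> 'm) precat)"
proof -
  let ?T = "twist_algebra \<theta> S" and ?\<theta>' = "\<lambda>i. inv_into (carrier S) (\<theta> i)"
  interpret graded_algebra K S by (rule assms(1))
  interpret K: field K by (rule field_K)
  interpret tw: twist_pair K S ?T \<theta> ?\<theta>'
    by (rule twist_algebra_twist_pair[OF assms(5)])
  have inv: "twist_pair K ?T S ?\<theta>' \<theta>"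
    by (rule tw.inverse_twist_pair)
  have fc: "f \<in> carrier S" using assms(2) by (rule S.part_carrier)
  \<comment> \<open>An integer power is a natural power or the inverse of one, so natural exponents
    come first.\<close>
  have "lam [^]\<^bsub>K\<^esub> n \<in> Units K" for n :: nat
  proof (induction n)
    case (Suc n)
    have "lam \<in> Units K" using assms(6,7) by (simp add: K.field_Units)
    with Suc show ?case by simp
  qed simp
  then have unit: "lam [^]\<^bsub>K\<^esub> i \<in> Units K" for i :: int
    by (auto simp only: int_pow_def2 V.Units_inv_Units split: if_splits)
  then have eigen: "\<exists>c\<in>Units K. \<theta> i f = c \<odot>\<^bsub>S\<^esub> f" for i
    using assms(8) by blast
  \<comment> \<open>Since \<open>\<theta> i\<close> is linear, it sends the inverse power times
    \<open>f\<close> back to \<open>f\<close>; the inverse family thus has the inverse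
    eigenvalue.\<close>
  have eigen': "\<exists>c\<in>Units K. ?\<theta>' i f = c \<odot>\<^bsub>?T\<^esub> f" for i
  proof (rule bexI)
    let ?c = "lam [^]\<^bsub>K\<^esub> i"
    have c: "inv\<^bsub>K\<^esub> ?c \<in> carrier K" using unit by simp
    show "?\<theta>' i f = (inv\<^bsub>K\<^esub> ?c) \<odot>\<^bsub>?T\<^esub> f"
      unfolding tw.T_simps
      by (rule tw.inverse_eqI)
        (use fc c unit in \<open>simp_all add: tw.twist_smult assms(8) tw.unit_smult_cancel\<close>)
    show "inv\<^bsub>K\<^esub> ?c \<in> Units K" using unit by simp
  qed
  have f': "f \<in> part ?T (int d)" using assms(2) by simp
  \<comment> \<open>The quasi-inverse is the twist by \<open>?\<theta>'\<close>; its functoriality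
    and the second natural isomorphism are the same lemmas for the exchanged pair.\<close>
  have "equivalence_functor (NMF K S d f :: (('a, 'm) factorization, int \<Rightarrow> 'm \<Rightarrow> 'm) precat)
      (NMF K ?T d f) (twist_functor \<theta>)"
    unfolding equivalence_functor_def
    using tw.twist_functor[OF assms(2) eigen] tw.twist_inverse_natural[OF assms(2) eigen]
      twist_pair.twist_functor[OF inv f' eigen'] twist_pair.twist_inverse_natural[OF inv f' eigen']
    by blast
  then show ?thesis
    unfolding equivalent_categories_def by blast
qed

end
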